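(* The functors $\mathrm{K}$ and $\mathrm{C}$ establish a categorical equivalence between the category $\mathsf{tDLI}^{+}_{0}$ and the category $\mathsf{itKI}_{c}$, with natural isomorphisms $\alpha$ and $\beta$. Here $\alpha_{\mathbf{L}}:\mathbf{L}\to \mathrm{C}(\mathrm{K}(\mathbf{L}))$ is $\alpha_{\mathbf{L}}(x)=(x,0)$ and $\beta_{\mathbf{U}}:\mathbf{U}\to \mathrm{K}(\mathrm{C}(\mathbf{U}))$ is $\beta_{\mathbf{U}}(x)=(x\vee c,\sim x\vee c)$.
   Context: A DLI-algebra is an algebra $\langle A,\wedge,\vee,\rightarrow,0,1\rangle$ such that $\langle A,\wedge,\vee,0,1\rangle$ is a bounded distributive lattice and for all $a,b,d$: (I1) $(a\to b)\wedge(a\to d)=a\to(b\wedge d)$; (I2) $(a\to d)\wedge(b\to d)=(a\vee b)\to d$; (I3) $0\to a=1$; (I4) $a\to 1=1$. A DLI$^{+}$-algebra additionally satisfies (I5) $a\wedge(a\to b)\le b$. A tense DLI$^{+}$-algebra is $\mathbf{L}=(\mathbf{A},G,H,F,P)$ with $\mathbf{A}$ a DLI$^{+}$-algebra and $G,H,F,P$ unary operations such that for all $x,y$: (T1) $P(x)\le y$ iff $x\le G(y)$; (T2) $F(x)\le y$ iff $x\le H(y)$; (T3) $G(x)\wedge F(y)\le F(x\wedge y)$ and $H(x)\wedge P(y)\le P(x\wedge y)$; (T4) $G(x\vee y)\le G(x)\vee F(y)$ and $H(x\vee y)\le H(x)\vee P(y)$; (T5) $G(x\to y)\le G(x)\to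 G(y)$ and $H(x\to y)\le H(x)\to H(y)$; (T6) $G(x\to y)\le F(x)\to F(y)$ and $H(x\to y)\le P(x)\to P(y)$. $\mathsf{tDLI}^{+}_{0}$ is the category of tense DLI$^{+}$-algebras with $G(0)=0=H(0)$ and homomorphisms (maps preserving $\wedge,\vee,\to,0,1,G,H,F,P$). A centered Kleene algebra is $\langle T,\wedge,\vee,\sim,c,0,1\rangle$ with $\langle T,\wedge,\vee,0,1\rangle$ a bounded distributive lattice, $\sim\sim x=x$, $\sim(x\vee y)=\sim x\wedge\sim y$, $x\wedge\sim x\le y\vee\sim y$, and $\sim c=c$. A KI-algebra is $\langle T,\wedge,\vee,\Rightarrow,\sim,c,0,1\rangle$ with centered Kleene reduct such that (KI1) $\langle T,\vee,\wedge,\Rightarrow,0,1\rangle$ is a DLI-algebra; (KI2) $(x\wedge(x\Rightarrow y))\vee c\le y\vee c$; (KI3) $c\Rightarrow c=1$; (KI4) $(x\Rightarrow y)\wedge c=(\sim x\vee y)\wedge c$; (KI5) $(x\Rightarrow\sim y)\vee c=(x\Rightarrow(\sim y\vee c))\wedge(y\Rightarrow(\sim x\vee c))$. A tense KI-algebra is $(\mathbf{T},G,H)$, $\mathbf{T}$ a KI-algebra, $G,H$ unary, with $F(x):=\sim G(\sim x)$, $P(x):=\sim H(\sim x)$, such that (t1) $G(1)=H(1)=1$; (t2) $G(x\wedge y)=G(x)\wedge G(y)$, $H(x\wedge y)=H(x)\wedge H(y)$; (t3) $x\le GP(x)$, $x\le HF(x)$; (t4) $G(x\vee y)\le G(x)\vee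 F(y)$, $H(x\vee y)\le H(x)\vee P(y)$; (t5) $G(x\Rightarrow y)\le G(x)\Rightarrow G(y)$, $H(x\Rightarrow y)\le H(x)\Rightarrow H(y)$; (t6) $G(x\Rightarrow y)\le F(x)\Rightarrow F(y)$, $H(x\Rightarrow y)\le P(x)\Rightarrow P(y)$. It is centered if $G(c)=c=H(c)$. Condition (CK): for all $x,y\in T$ with $x,y\ge c$ and $x\wedge y\le c$ there is $z\in T$ with $z\vee c=x$ and $\sim z\vee c=y$. $\mathsf{itKI}_{c}$ is the category of tense centered KI-algebras satisfying (CK), with homomorphisms (preserving $\wedge,\vee,\Rightarrow,\sim,c,0,1,G,H$). Functor K: for $\mathbf{L}\in\mathsf{tDLI}^{+}_{0}$, $K(A)=\{(a,b)\in A\times A: a\wedge b=0\}$ with $(a,b)\vee(x,y)=(a\vee x,b\wedge y)$, $(a,b)\wedge(x,y)=(a\wedge x,b\vee y)$, $(a,b)\Rightarrow(x,y)=((a\to x)\wedge(y\to b),a\wedge y)$, $\sim(a,b)=(b,a)$, $0=(0,1)$, $1=(1,0)$, $c=(0,0)$, $G_K(a,b)=(G(a),F(b))$, $H_K(a,b)=(H(a),P(b))$; $\mathrm{K}(\mathbf{L})=(K(A),\dots,G_K,H_K)$ and $\mathrm{K}(f)(x,y)=(f(x),f(y))$. Functor C: for a tense centered KI-algebra $\mathbf{U}=(\mathbf{T},G,H)$, $C(T)=\{x\in T:x\ge c\}$ and $\mathrm{C}(\mathbf{U})=(C(T),\wedge,\vee,\Rightarrow,c,1,G,H,F,P)$ with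 all operations restricted ($c$ the bottom); $\mathrm{C}(f)$ is the restriction of $f$. *)

theory Defs
  imports "HOL-Library.FuncSet"
begin

section \<open>Categories, functors, natural isomorphisms\<close>

record ('o, 'm) cat_data =
  Obj :: "'o set"
  Arr :: "'m set"
  Dom :: "'m \<Rightarrow> 'o"
  Cod :: "'m \<Rightarrow> 'o"
  Ide :: "'o \<Rightarrow> 'm"
  Comp :: "'m \<Rightarrow> 'm \<Rightarrow> 'm"  \<comment> \<open>\<open>Comp C g f\<close> is \<open>g\<close> after \<open>f\<close>\<close>

locale category =
  fixes C :: "('o, 'm) cat_data"
  assumes dom_obj: "f \<in> Arr C \<Longrightarrow> Dom C f \<in> Obj C"
    and cod_obj: "f \<in> Arr C \<Longrightarrow> Cod C f \<in> Obj C"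
    and ide_arr: "X \<in> Obj C \<Longrightarrow> Ide C X \<in> Arr C"
    and ide_dom: "X \<in> Obj C \<Longrightarrow> Dom C (Ide C X) = X"
    and ide_cod: "X \<in> Obj C \<Longrightarrow> Cod C (Ide C X) = X"
    and comp_arr: "\<lbrakk>f \<in> Arr C; g \<in> Arr C; Cod C f = Dom C g\<rbrakk> \<Longrightarrow> Comp C g f \<in> Arr C"
    and comp_dom: "\<lbrakk>f \<in> Arr C; g \<in> Arr C; Cod C f = Dom C g\<rbrakk> \<Longrightarrow> Dom C (Comp C g f) = Dom C f"
    and comp_cod: "\<lbrakk>f \<in> Arr C; g \<in> Arr C; Cod C f = Dom C g\<rbrakk> \<Longrightarrow> Cod C (Comp C g f) = Cod C g"
    and comp_ide_right: "f \<in> Arr C \<Longrightarrow> Comp C f (Ide C (Dom C f)) = f"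
    and comp_ide_left: "f \<in> Arr C \<Longrightarrow> Comp C (Ide C (Cod C f)) f = f"
    and comp_assoc: "\<lbrakk>f \<in> Arr C; g \<in> Arr C; h \<in> Arr C; Cod C f = Dom C g; Cod C g = Dom C h\<rbrakk>
      \<Longrightarrow> Comp C h (Comp C g f) = Comp C (Comp C h g) f"

definition iso_arr :: "('o, 'm) cat_data \<Rightarrow> 'm \<Rightarrow> bool" where
  "iso_arr C f \<longleftrightarrow> f \<in> Arr C \<and>
    (\<exists>g \<in> Arr C. Dom C g = Cod C f \<and> Cod C g = Dom C f \<and>
       Comp C g f = Ide C (Dom C f) \<and> Comp C f g = Ide C (Cod C f))"

record ('o, 'm, 'p, 'n) fun_data =
  OMap :: "'o \<Rightarrow> 'p"
  AMap :: "'m \<Rightarrow> 'n"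

locale cat_functor = source: category C + target: category D
  for C :: "('o, 'm) cat_data" and D :: "('p, 'n) cat_data" +
  fixes \<Phi> :: "('o, 'm, 'p, 'n) fun_data"
  assumes omap_obj: "X \<in> Obj C \<Longrightarrow> OMap \<Phi> X \<in> Obj D"
    and amap_arr: "f \<in> Arr C \<Longrightarrow> AMap \<Phi> f \<in> Arr D"
    and amap_dom: "f \<in> Arr C \<Longrightarrow> Dom D (AMap \<Phi> f) = OMap \<Phi> (Dom C f)"
    and amap_cod: "f \<in> Arr C \<Longrightarrow> Cod D (AMap \<Phi> f) = OMap \<Phi> (Cod C f)"
    and amap_ide: "X \<in> Obj C \<Longrightarrow> AMap \<Phi> (Ide C X) = Ide D (OMap \<Phi> X)"
    and amap_comp: "\<lbrakk>f \<in> Arr C; g \<in> Arr C; Cod C f = Dom C g\<rbrakk>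
      \<Longrightarrow> AMap \<Phi> (Comp C g f) = Comp D (AMap \<Phi> g) (AMap \<Phi> f)"

definition id_functor :: "('o, 'm, 'o, 'm) fun_data" where
  "id_functor = \<lparr>OMap = (\<lambda>X. X), AMap = (\<lambda>f. f)\<rparr>"

definition comp_functor ::
  "('p, 'n, 'q, 'k) fun_data \<Rightarrow> ('o, 'm, 'p, 'n) fun_data \<Rightarrow> ('o, 'm, 'q, 'k) fun_data" where
  "comp_functor \<Psi> \<Phi> = \<lparr>OMap = OMap \<Psi> \<circ> OMap \<Phi>, AMap = AMap \<Psi> \<circ> AMap \<Phi>\<rparr>"

locale natural_transformation = dom_functor: cat_functor C D \<Phi> + cod_functor: cat_functor C D \<Psi>
  for C :: "('o, 'm) cat_data" and D :: "('p, 'n) cat_data" and \<Phi> \<Psi> +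
  fixes \<eta> :: "'o \<Rightarrow> 'n"
  assumes component_arr: "X \<in> Obj C \<Longrightarrow> \<eta> X \<in> Arr D"
    and component_dom: "X \<in> Obj C \<Longrightarrow> Dom D (\<eta> X) = OMap \<Phi> X"
    and component_cod: "X \<in> Obj C \<Longrightarrow> Cod D (\<eta> X) = OMap \<Psi> X"
    and naturality: "f \<in> Arr C \<Longrightarrow>
      Comp D (AMap \<Psi> f) (\<eta> (Dom C f)) = Comp D (\<eta> (Cod C f)) (AMap \<Phi> f)"

locale natural_isomorphism = natural_transformation +
  assumes component_iso: "X \<in> Obj C \<Longrightarrow> iso_arr D (\<eta> X)"

definition categorical_equivalence ::
  "('o, 'm) cat_data \<Rightarrow> ('p, 'n) cat_data \<Rightarrow> ('o, 'm, 'p, 'n) fun_data \<Rightarrow>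
   ('p, 'n, 'o, 'm) fun_data \<Rightarrow> ('o \<Rightarrow> 'm) \<Rightarrow> ('p \<Rightarrow> 'n) \<Rightarrow> bool" where
  "categorical_equivalence C D \<Phi> \<Psi> \<eta> \<epsilon> \<longleftrightarrow>
     cat_functor C D \<Phi> \<and> cat_functor D C \<Psi> \<and>
     natural_isomorphism C C id_functor (comp_functor \<Psi> \<Phi>) \<eta> \<and>
     natural_isomorphism D D id_functor (comp_functor \<Phi> \<Psi>) \<epsilon>"


section \<open>The algebras\<close>

definition meet_le :: "('a \<Rightarrow> 'a \<Rightarrow> 'a) \<Rightarrow> 'a \<Rightarrow> 'a \<Rightarrow> bool" where
  "meet_le m x y \<longleftrightarrow> m x y = x"

definition dual_op :: "('a \<Rightarrow> 'a) \<Rightarrow> ('a \<Rightarrow> 'a) \<Rightarrow> 'a \<Rightarrow> 'a" where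
  "dual_op neg g x = neg (g (neg x))"

locale bounded_dlattice =
  fixes A :: "'a set"
    and meet :: "'a \<Rightarrow> 'a \<Rightarrow> 'a" (infixl "\<sqinter>" 70)
    and join :: "'a \<Rightarrow> 'a \<Rightarrow> 'a" (infixl "\<squnion>" 65)
    and zero :: 'a ("\<zero>")
    and one :: 'a ("\<one>")
  assumes meet_closed: "\<lbrakk>x \<in> A; y \<in> A\<rbrakk> \<Longrightarrow> x \<sqinter> y \<in> A"
    and join_closed: "\<lbrakk>x \<in> A; y \<in> A\<rbrakk> \<Longrightarrow> x \<squnion> y \<in> A"
    and zero_closed: "\<zero> \<in> A"
    and one_closed: "\<one> \<in> A"
    and meet_comm: "\<lbrakk>x \<in> A; y \<in> A\<rbrakk> \<Longrightarrow> x \<sqinter> y = y \<sqinter> x"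
    and join_comm: "\<lbrakk>x \<in> A; y \<in> A\<rbrakk> \<Longrightarrow> x \<squnion> y = y \<squnion> x"
    and meet_assoc: "\<lbrakk>x \<in> A; y \<in> A; z \<in> A\<rbrakk> \<Longrightarrow> (x \<sqinter> y) \<sqinter> z = x \<sqinter> (y \<sqinter> z)"
    and join_assoc: "\<lbrakk>x \<in> A; y \<in> A; z \<in> A\<rbrakk> \<Longrightarrow> (x \<squnion> y) \<squnion> z = x \<squnion> (y \<squnion> z)"
    and meet_absorb: "\<lbrakk>x \<in> A; y \<in> A\<rbrakk> \<Longrightarrow> x \<sqinter> (x \<squnion> y) = x"
    and join_absorb: "\<lbrakk>x \<in> A; y \<in> A\<rbrakk> \<Longrightarrow> x \<squnion> (x \<sqinter> y) = x"
    and distrib: "\<lbrakk>x \<in> A; y \<in> A; z \<in> A\<rbrakk> \<Longrightarrow> x \<sqinter> (y \<squnion> z) = (x \<sqinter> y) \<squnion> (x \<sqinter> z)"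
    and zero_least: "x \<in> A \<Longrightarrow> meet_le meet \<zero> x"
    and one_greatest: "x \<in> A \<Longrightarrow> meet_le meet x \<one>"
begin

abbreviation le (infix "\<sqsubseteq>" 50) where "x \<sqsubseteq> y \<equiv> meet_le meet x y"

end

locale dli_algebra = bounded_dlattice +
  fixes imp :: "'a \<Rightarrow> 'a \<Rightarrow> 'a" (infixr "\<leadsto>" 75)
  assumes imp_closed: "\<lbrakk>x \<in> A; y \<in> A\<rbrakk> \<Longrightarrow> x \<leadsto> y \<in> A"
    and I1: "\<lbrakk>a \<in> A; b \<in> A; d \<in> A\<rbrakk> \<Longrightarrow> (a \<leadsto> b) \<sqinter> (a \<leadsto> d) = a \<leadsto> (b \<sqinter> d)"
    and I2: "\<lbrakk>a \<in> A; b \<in> A; d \<in> A\<rbrakk> \<Longrightarrow> (a \<leadsto> d) \<sqinter> (b \<leadsto> d) = (a \<squnion> b) \<leadsto> d"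
    and I3: "a \<in> A \<Longrightarrow> \<zero> \<leadsto> a = \<one>"
    and I4: "a \<in> A \<Longrightarrow> a \<leadsto> \<one> = \<one>"

locale dli_plus_algebra = dli_algebra +
  assumes I5: "\<lbrakk>a \<in> A; b \<in> A\<rbrakk> \<Longrightarrow> a \<sqinter> (a \<leadsto> b) \<sqsubseteq> b"

locale tense_dli_plus_algebra = dli_plus_algebra +
  fixes G H F P :: "'a \<Rightarrow> 'a"
  assumes G_closed: "x \<in> A \<Longrightarrow> G x \<in> A"
    and H_closed: "x \<in> A \<Longrightarrow> H x \<in> A"
    and F_closed: "x \<in> A \<Longrightarrow> F x \<in> A"
    and P_closed: "x \<in> A \<Longrightarrow> P x \<in> A"
    and T1: "\<lbrakk>x \<in> A; y \<in> A\<rbrakk> \<Longrightarrow> P x \<sqsubseteq> y \<longleftrightarrow> x \<sqsubseteq> G y"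
    and T2: "\<lbrakk>x \<in> A; y \<in> A\<rbrakk> \<Longrightarrow> F x \<sqsubseteq> y \<longleftrightarrow> x \<sqsubseteq> H y"
    and T3_G: "\<lbrakk>x \<in> A; y \<in> A\<rbrakk> \<Longrightarrow> G x \<sqinter> F y \<sqsubseteq> F (x \<sqinter> y)"
    and T3_H: "\<lbrakk>x \<in> A; y \<in> A\<rbrakk> \<Longrightarrow> H x \<sqinter> P y \<sqsubseteq> P (x \<sqinter> y)"
    and T4_G: "\<lbrakk>x \<in> A; y \<in> A\<rbrakk> \<Longrightarrow> G (x \<squnion> y) \<sqsubseteq> G x \<squnion> F y"
    and T4_H: "\<lbrakk>x \<in> A; y \<in> A\<rbrakk> \<Longrightarrow> H (x \<squnion> y) \<sqsubseteq> H x \<squnion> P y"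
    and T5_G: "\<lbrakk>x \<in> A; y \<in> A\<rbrakk> \<Longrightarrow> G (x \<leadsto> y) \<sqsubseteq> G x \<leadsto> G y"
    and T5_H: "\<lbrakk>x \<in> A; y \<in> A\<rbrakk> \<Longrightarrow> H (x \<leadsto> y) \<sqsubseteq> H x \<leadsto> H y"
    and T6_G: "\<lbrakk>x \<in> A; y \<in> A\<rbrakk> \<Longrightarrow> G (x \<leadsto> y) \<sqsubseteq> F x \<leadsto> F y"
    and T6_H: "\<lbrakk>x \<in> A; y \<in> A\<rbrakk> \<Longrightarrow> H (x \<leadsto> y) \<sqsubseteq> P x \<leadsto> P y"

locale tense_dli_plus_algebra_0 = tense_dli_plus_algebra +
  assumes G_zero: "G \<zero> = \<zero>" and H_zero: "H \<zero> = \<zero>"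

locale centered_kleene_algebra = bounded_dlattice +
  fixes neg :: "'a \<Rightarrow> 'a" ("\<sim> _" [90] 90)
    and c :: 'a
  assumes neg_closed: "x \<in> A \<Longrightarrow> \<sim> x \<in> A"
    and center_closed: "c \<in> A"
    and neg_neg: "x \<in> A \<Longrightarrow> \<sim> (\<sim> x) = x"
    and neg_join: "\<lbrakk>x \<in> A; y \<in> A\<rbrakk> \<Longrightarrow> \<sim> (x \<squnion> y) = \<sim> x \<sqinter> \<sim> y"
    and kleene: "\<lbrakk>x \<in> A; y \<in> A\<rbrakk> \<Longrightarrow> x \<sqinter> \<sim> x \<sqsubseteq> y \<squnion> \<sim> y"
    and neg_center: "\<sim> c = c"

locale ki_algebra = centered_kleene_algebra + dli_algebra +
  assumes KI2: "\<lbrakk>x \<in> A; y \<in> A\<rbrakk> \<Longrightarrow> (x \<sqinter> (x \<leadsto> y)) \<squnion> c \<sqsubseteq> y \<squnion> c"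
    and KI3: "c \<leadsto> c = \<one>"
    and KI4: "\<lbrakk>x \<in> A; y \<in> A\<rbrakk> \<Longrightarrow> (x \<leadsto> y) \<sqinter> c = (\<sim> x \<squnion> y) \<sqinter> c"
    and KI5: "\<lbrakk>x \<in> A; y \<in> A\<rbrakk> \<Longrightarrow>
      (x \<leadsto> \<sim> y) \<squnion> c = (x \<leadsto> (\<sim> y \<squnion> c)) \<sqinter> (y \<leadsto> (\<sim> x \<squnion> c))"

locale tense_ki_signature = ki_algebra +
  fixes G H :: "'a \<Rightarrow> 'a"
begin

abbreviation F where "F \<equiv> dual_op neg G"
abbreviation P where "P \<equiv> dual_op neg H"

end

locale tense_ki_algebra = tense_ki_signature +
  assumes G_closed: "x \<in> A \<Longrightarrow> G x \<in> A"
    and H_closed: "x \<in> A \<Longrightarrow> H x \<in> A"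
    and t1_G: "G \<one> = \<one>"
    and t1_H: "H \<one> = \<one>"
    and t2_G: "\<lbrakk>x \<in> A; y \<in> A\<rbrakk> \<Longrightarrow> G (x \<sqinter> y) = G x \<sqinter> G y"
    and t2_H: "\<lbrakk>x \<in> A; y \<in> A\<rbrakk> \<Longrightarrow> H (x \<sqinter> y) = H x \<sqinter> H y"
    and t3_G: "x \<in> A \<Longrightarrow> x \<sqsubseteq> G (P x)"
    and t3_H: "x \<in> A \<Longrightarrow> x \<sqsubseteq> H (F x)"
    and t4_G: "\<lbrakk>x \<in> A; y \<in> A\<rbrakk> \<Longrightarrow> G (x \<squnion> y) \<sqsubseteq> G x \<squnion> F y"
    and t4_H: "\<lbrakk>x \<in> A; y \<in> A\<rbrakk> \<Longrightarrow> H (x \<squnion> y) \<sqsubseteq> H x \<squnion> P y"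
    and t5_G: "\<lbrakk>x \<in> A; y \<in> A\<rbrakk> \<Longrightarrow> G (x \<leadsto> y) \<sqsubseteq> G x \<leadsto> G y"
    and t5_H: "\<lbrakk>x \<in> A; y \<in> A\<rbrakk> \<Longrightarrow> H (x \<leadsto> y) \<sqsubseteq> H x \<leadsto> H y"
    and t6_G: "\<lbrakk>x \<in> A; y \<in> A\<rbrakk> \<Longrightarrow> G (x \<leadsto> y) \<sqsubseteq> F x \<leadsto> F y"
    and t6_H: "\<lbrakk>x \<in> A; y \<in> A\<rbrakk> \<Longrightarrow> H (x \<leadsto> y) \<sqsubseteq> P x \<leadsto> P y"

locale tense_centered_ki_algebra = tense_ki_algebra +
  assumes G_center: "G c = c" and H_center: "H c = c"

locale tense_centered_ki_algebra_CK = tense_centered_ki_algebra +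
  assumes CK: "\<lbrakk>x \<in> A; y \<in> A; c \<sqsubseteq> x; c \<sqsubseteq> y; x \<sqinter> y \<sqsubseteq> c\<rbrakk>
    \<Longrightarrow> \<exists>z \<in> A. z \<squnion> c = x \<and> \<sim> z \<squnion> c = y"


section \<open>The two categories\<close>

text \<open>As usual with carrier sets, the values of the operations outside the carrier are unconstrained.
  Structures that differ only there are distinct objects, isomorphic through the identity map.\<close>

record 'a tense_sig =
  carrier :: "'a set"
  meet_of :: "'a \<Rightarrow> 'a \<Rightarrow> 'a"
  join_of :: "'a \<Rightarrow> 'a \<Rightarrow> 'a"
  imp_of :: "'a \<Rightarrow> 'a \<Rightarrow> 'a"
  zero_of :: 'a
  one_of :: 'a
  G_of :: "'a \<Rightarrow> 'a"
  H_of :: "'a \<Rightarrow> 'a"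

record 'a tdli = "'a tense_sig" +
  F_of :: "'a \<Rightarrow> 'a"
  P_of :: "'a \<Rightarrow> 'a"

record 'a tki = "'a tense_sig" +
  neg_of :: "'a \<Rightarrow> 'a"
  center_of :: 'a

definition tdli0_objects :: "'a tdli set" where
  "tdli0_objects = {L. tense_dli_plus_algebra_0 (carrier L) (meet_of L) (join_of L)
     (zero_of L) (one_of L) (imp_of L) (G_of L) (H_of L) (F_of L) (P_of L)}"

definition itki_objects :: "'a tki set" where
  "itki_objects = {U. tense_centered_ki_algebra_CK (carrier U) (meet_of U) (join_of U)
     (zero_of U) (one_of U) (neg_of U) (center_of U) (imp_of U) (G_of U) (H_of U)}"

definition preserves_op1 :: "'a set \<Rightarrow> ('a \<Rightarrow> 'b) \<Rightarrow> ('a \<Rightarrow> 'a) \<Rightarrow> ('b \<Rightarrow> 'b) \<Rightarrow> bool" where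
  "preserves_op1 A f u v \<longleftrightarrow> (\<forall>x \<in> A. f (u x) = v (f x))"

definition preserves_op2 ::
  "'a set \<Rightarrow> ('a \<Rightarrow> 'b) \<Rightarrow> ('a \<Rightarrow> 'a \<Rightarrow> 'a) \<Rightarrow> ('b \<Rightarrow> 'b \<Rightarrow> 'b) \<Rightarrow> bool" where
  "preserves_op2 A f u v \<longleftrightarrow> (\<forall>x \<in> A. \<forall>y \<in> A. f (u x y) = v (f x) (f y))"

text \<open>Homomorphisms are extensional functions on the carrier, so that equality of morphisms is
  equality of maps.\<close>

definition tense_sig_hom ::
  "('a, 'r) tense_sig_scheme \<Rightarrow> ('b, 's) tense_sig_scheme \<Rightarrow> ('a \<Rightarrow> 'b) set" where
  "tense_sig_hom L M = {f \<in> carrier L \<rightarrow>\<^sub>E carrier M.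
     preserves_op2 (carrier L) f (meet_of L) (meet_of M) \<and>
     preserves_op2 (carrier L) f (join_of L) (join_of M) \<and>
     preserves_op2 (carrier L) f (imp_of L) (imp_of M) \<and>
     f (zero_of L) = zero_of M \<and> f (one_of L) = one_of M \<and>
     preserves_op1 (carrier L) f (G_of L) (G_of M) \<and>
     preserves_op1 (carrier L) f (H_of L) (H_of M)}"

definition tdli_hom :: "'a tdli \<Rightarrow> 'b tdli \<Rightarrow> ('a \<Rightarrow> 'b) set" where
  "tdli_hom L M = {f \<in> tense_sig_hom L M.
     preserves_op1 (carrier L) f (F_of L) (F_of M) \<and>
     preserves_op1 (carrier L) f (P_of L) (P_of M)}"

definition tki_hom :: "'a tki \<Rightarrow> 'b tki \<Rightarrow> ('a \<Rightarrow> 'b) set" where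
  "tki_hom U V = {f \<in> tense_sig_hom U V.
     preserves_op1 (carrier U) f (neg_of U) (neg_of V) \<and>
     f (center_of U) = center_of V}"

type_synonym ('a, 'o) arrow = "'o \<times> ('a \<Rightarrow> 'a) \<times> 'o"  \<comment> \<open>domain, map, codomain\<close>

definition algebra_category ::
  "('a, 'r) tense_sig_scheme set \<Rightarrow>
   (('a, 'r) tense_sig_scheme \<Rightarrow> ('a, 'r) tense_sig_scheme \<Rightarrow> ('a \<Rightarrow> 'a) set) \<Rightarrow>
   (('a, 'r) tense_sig_scheme, ('a, ('a, 'r) tense_sig_scheme) arrow) cat_data" where
  "algebra_category objs homs = \<lparr>
     Obj = objs,
     Arr = {(L, f, M). L \<in> objs \<and> M \<in> objs \<and> f \<in> homs L M},
     Dom = (\<lambda>(L, f, M). L),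
     Cod = (\<lambda>(L, f, M). M),
     Ide = (\<lambda>L. (L, \<lambda>x \<in> carrier L. x, L)),
     Comp = (\<lambda>(M, g, N) (L, f, M'). (L, compose (carrier L) g f, N))\<rparr>"

text \<open>\<open>K\<close> squares the carrier, so both categories are formed over a type that is closed under
  ordered pairs. Any algebra with carrier in an arbitrary type \<open>'a\<close> has an isomorphic copy with
  carrier in \<open>'a univ\<close>, along \<open>Atom\<close>.\<close>

datatype 'a univ = Atom 'a | Pair (pfst: "'a univ") (psnd: "'a univ")

definition tDLI0 :: "('a univ tdli, ('a univ, 'a univ tdli) arrow) cat_data" where
  "tDLI0 = algebra_category tdli0_objects tdli_hom"

definition itKIc :: "('a univ tki, ('a univ, 'a univ tki) arrow) cat_data" where
  "itKIc = algebra_category itki_objects tki_hom"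


section \<open>The functors and the natural isomorphisms\<close>

definition K_obj :: "'a univ tdli \<Rightarrow> 'a univ tki" where
  "K_obj L = \<lparr>
     carrier = {Pair a b | a b. a \<in> carrier L \<and> b \<in> carrier L \<and> meet_of L a b = zero_of L},
     meet_of = (\<lambda>u v. Pair (meet_of L (pfst u) (pfst v)) (join_of L (psnd u) (psnd v))),
     join_of = (\<lambda>u v. Pair (join_of L (pfst u) (pfst v)) (meet_of L (psnd u) (psnd v))),
     imp_of = (\<lambda>u v. Pair
        (meet_of L (imp_of L (pfst u) (pfst v)) (imp_of L (psnd v) (psnd u)))
        (meet_of L (pfst u) (psnd v))),
     zero_of = Pair (zero_of L) (one_of L),
     one_of = Pair (one_of L) (zero_of L),
     G_of = (\<lambda>u. Pair (G_of L (pfst u)) (F_of L (psnd u))),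
     H_of = (\<lambda>u. Pair (H_of L (pfst u)) (P_of L (psnd u))),
     neg_of = (\<lambda>u. Pair (psnd u) (pfst u)),
     center_of = Pair (zero_of L) (zero_of L)\<rparr>"

definition K_functor ::
  "('a univ tdli, ('a univ, 'a univ tdli) arrow, 'a univ tki, ('a univ, 'a univ tki) arrow) fun_data"
  where
  "K_functor = \<lparr>
     OMap = K_obj,
     AMap = (\<lambda>(L, f, M).
       (K_obj L, \<lambda>u \<in> carrier (K_obj L). Pair (f (pfst u)) (f (psnd u)), K_obj M))\<rparr>"

definition C_obj :: "'a tki \<Rightarrow> 'a tdli" where
  "C_obj U = \<lparr>
     carrier = {x \<in> carrier U. meet_le (meet_of U) (center_of U) x},
     meet_of = meet_of U,
     join_of = join_of U,
     imp_of = imp_of U,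
     zero_of = center_of U,
     one_of = one_of U,
     G_of = G_of U,
     H_of = H_of U,
     F_of = dual_op (neg_of U) (G_of U),
     P_of = dual_op (neg_of U) (H_of U)\<rparr>"

definition C_functor ::
  "('a univ tki, ('a univ, 'a univ tki) arrow, 'a univ tdli, ('a univ, 'a univ tdli) arrow) fun_data"
  where
  "C_functor = \<lparr>
     OMap = C_obj,
     AMap = (\<lambda>(U, f, V). (C_obj U, restrict f (carrier (C_obj U)), C_obj V))\<rparr>"

definition alpha :: "'a univ tdli \<Rightarrow> ('a univ, 'a univ tdli) arrow" where
  "alpha L = (L, \<lambda>x \<in> carrier L. Pair x (zero_of L), C_obj (K_obj L))"

definition beta :: "'a univ tki \<Rightarrow> ('a univ, 'a univ tki) arrow" where
  "beta U = (U,
     \<lambda>x \<in> carrier U. Pair (join_of U x (center_of U)) (join_of U (neg_of U x) (center_of U)),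
     K_obj (C_obj U))"

end

theory Submission
  imports Defs
begin

text \<open>
  The functor \<open>K\<close> is the Kalman twist construction: a pair \<open>(a, b)\<close> with \<open>a \<and> b = 0\<close> encodes
  \<open>a\<close> as the part of an element above the center and \<open>b\<close> as the part of its negation
  above the center. In a centered Kleene algebra \<open>x\<close> is determined by \<open>x \<or> c\<close> and
  \<open>\<sim>x \<or> c\<close>, because the second one is the negation of \<open>x \<and> c\<close> and distributive lattices are
  cancellative; (CK) says that every admissible pair arises in this way. That \<open>\<beta>\<close> preserves
  \<open>\<Rightarrow>\<close> is (KI5) for the first coordinate and (KI4) for the second, and that it preserves \<open>G\<close>
  follows from \<open>G (x \<or> c) = G x \<or> c\<close>, which is (t4) together with \<open>F c = c\<close>.
\<close>

section \<open>Lattices, DLI-algebras and tense operators\<close>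

context bounded_dlattice
begin

declare meet_closed [simp] join_closed [simp] zero_closed [simp] one_closed [simp]
  zero_least [simp] one_greatest [simp]

lemma meet_idem [simp]: "x \<in> A \<Longrightarrow> x \<sqinter> x = x"
  by (metis meet_absorb join_absorb meet_closed)

lemma join_idem [simp]: "x \<in> A \<Longrightarrow> x \<squnion> x = x"
  by (metis join_absorb meet_idem)

lemma le_refl [simp]: "x \<in> A \<Longrightarrow> x \<sqsubseteq> x"
  by (simp add: meet_le_def)

lemma le_antisym: "\<lbrakk>x \<sqsubseteq> y; y \<sqsubseteq> x; x \<in> A; y \<in> A\<rbrakk> \<Longrightarrow> x = y"
  by (metis meet_le_def meet_comm)

lemma le_trans [trans]: "\<lbrakk>x \<sqsubseteq> y; y \<sqsubseteq> z; x \<in> A; y \<in> A; z \<in> A\<rbrakk> \<Longrightarrow> x \<sqsubseteq> z"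
  unfolding meet_le_def by (metis meet_assoc)

lemma meet_lower1 [simp]: "\<lbrakk>x \<in> A; y \<in> A\<rbrakk> \<Longrightarrow> x \<sqinter> y \<sqsubseteq> x"
  unfolding meet_le_def by (metis meet_assoc meet_comm meet_idem meet_closed)

lemma meet_lower2 [simp]: "\<lbrakk>x \<in> A; y \<in> A\<rbrakk> \<Longrightarrow> x \<sqinter> y \<sqsubseteq> y"
  unfolding meet_le_def by (metis meet_assoc meet_idem)

lemma meet_greatest: "\<lbrakk>z \<sqsubseteq> x; z \<sqsubseteq> y; x \<in> A; y \<in> A; z \<in> A\<rbrakk> \<Longrightarrow> z \<sqsubseteq> x \<sqinter> y"
  unfolding meet_le_def by (simp flip: meet_assoc)

lemma le_meet_iff: "\<lbrakk>x \<in> A; y \<in> A; z \<in> A\<rbrakk> \<Longrightarrow> z \<sqsubseteq> x \<sqinter> y \<longleftrightarrow> z \<sqsubseteq> x \<and> z \<sqsubseteq> y"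
  by (meson le_trans meet_closed meet_lower1 meet_lower2 meet_greatest)

lemma le_iff_join: "\<lbrakk>x \<in> A; y \<in> A\<rbrakk> \<Longrightarrow> x \<sqsubseteq> y \<longleftrightarrow> x \<squnion> y = y"
  unfolding meet_le_def by (metis join_absorb join_comm meet_absorb meet_comm)

lemma join_upper1 [simp]: "\<lbrakk>x \<in> A; y \<in> A\<rbrakk> \<Longrightarrow> x \<sqsubseteq> x \<squnion> y"
  by (simp add: meet_le_def meet_absorb)

lemma join_upper2 [simp]: "\<lbrakk>x \<in> A; y \<in> A\<rbrakk> \<Longrightarrow> y \<sqsubseteq> x \<squnion> y"
  by (metis join_comm join_upper1)

lemma join_least: "\<lbrakk>x \<sqsubseteq> z; y \<sqsubseteq> z; x \<in> A; y \<in> A; z \<in> A\<rbrakk> \<Longrightarrow> x \<squnion> y \<sqsubseteq> z"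
  by (simp add: le_iff_join join_assoc)

lemma join_le_iff: "\<lbrakk>x \<in> A; y \<in> A; z \<in> A\<rbrakk> \<Longrightarrow> x \<squnion> y \<sqsubseteq> z \<longleftrightarrow> x \<sqsubseteq> z \<and> y \<sqsubseteq> z"
  by (meson le_trans join_closed join_upper1 join_upper2 join_least)

lemma meet_mono: "\<lbrakk>x \<sqsubseteq> x'; y \<sqsubseteq> y'; x \<in> A; y \<in> A; x' \<in> A; y' \<in> A\<rbrakk> \<Longrightarrow> x \<sqinter> y \<sqsubseteq> x' \<sqinter> y'"
  by (rule meet_greatest[OF le_trans[OF meet_lower1] le_trans[OF meet_lower2]]) simp_all

lemma meet_left_comm: "\<lbrakk>x \<in> A; y \<in> A; z \<in> A\<rbrakk> \<Longrightarrow> x \<sqinter> (y \<sqinter> z) = y \<sqinter> (x \<sqinter> z)"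
  by (metis meet_assoc meet_comm)

lemma join_left_comm: "\<lbrakk>x \<in> A; y \<in> A; z \<in> A\<rbrakk> \<Longrightarrow> x \<squnion> (y \<squnion> z) = y \<squnion> (x \<squnion> z)"
  by (metis join_assoc join_comm)

lemmas meet_ac = meet_assoc meet_comm meet_left_comm
lemmas join_ac = join_assoc join_comm join_left_comm

lemma distrib_right:
  "\<lbrakk>x \<in> A; y \<in> A; z \<in> A\<rbrakk> \<Longrightarrow> (y \<squnion> z) \<sqinter> x = (y \<sqinter> x) \<squnion> (z \<sqinter> x)"
  by (simp add: distrib meet_comm)

text \<open>Only one distributive law is an axiom; its dual follows by expanding the right-hand side
  and absorbing. The second coordinate of the twist construction needs it.\<close>

lemma join_distrib:
  assumes "x \<in> A" "y \<in> A" "z \<in> A"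
  shows "x \<squnion> (y \<sqinter> z) = (x \<squnion> y) \<sqinter> (x \<squnion> z)"
proof -
  have "(x \<squnion> y) \<sqinter> (x \<squnion> z) = x \<squnion> (z \<sqinter> (x \<squnion> y))"
    using assms by (simp add: distrib[of "x \<squnion> y"] meet_comm[of _ x] meet_comm[of _ z] meet_absorb)
  also have "\<dots> = (x \<squnion> (x \<sqinter> z)) \<squnion> (y \<sqinter> z)"
    using assms by (simp add: distrib join_assoc meet_comm)
  finally show ?thesis
    using assms by (simp add: join_absorb)
qed

lemma join_distrib_right:
  "\<lbrakk>x \<in> A; y \<in> A; z \<in> A\<rbrakk> \<Longrightarrow> (y \<sqinter> z) \<squnion> x = (y \<squnion> x) \<sqinter> (z \<squnion> x)"
  by (simp add: join_distrib join_comm)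

lemma zero_meet [simp]: "x \<in> A \<Longrightarrow> \<zero> \<sqinter> x = \<zero>" "x \<in> A \<Longrightarrow> x \<sqinter> \<zero> = \<zero>"
  by (metis meet_comm meet_le_def zero_closed zero_least)+

lemma one_meet [simp]: "x \<in> A \<Longrightarrow> \<one> \<sqinter> x = x" "x \<in> A \<Longrightarrow> x \<sqinter> \<one> = x"
  by (metis meet_comm meet_le_def one_closed one_greatest)+

lemma zero_join [simp]: "x \<in> A \<Longrightarrow> \<zero> \<squnion> x = x" "x \<in> A \<Longrightarrow> x \<squnion> \<zero> = x"
  by (metis le_iff_join join_comm zero_closed zero_least)+

lemma one_join [simp]: "x \<in> A \<Longrightarrow> \<one> \<squnion> x = \<one>" "x \<in> A \<Longrightarrow> x \<squnion> \<one> = \<one>"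
  by (metis le_iff_join join_comm one_closed one_greatest)+

lemma le_zero_iff [simp]: "x \<in> A \<Longrightarrow> x \<sqsubseteq> \<zero> \<longleftrightarrow> x = \<zero>"
  by (metis meet_le_def zero_meet(2))

lemma disjoint_mono:
  "\<lbrakk>x \<sqinter> y = \<zero>; x' \<sqsubseteq> x; y' \<sqsubseteq> y; x \<in> A; y \<in> A; x' \<in> A; y' \<in> A\<rbrakk> \<Longrightarrow> x' \<sqinter> y' = \<zero>"
  by (metis le_zero_iff meet_closed meet_mono)

text \<open>After distributing, each of the two terms lies below one of the given disjoint meets.
  This closes the twist carrier under join and, with the coordinates swapped, under meet.\<close>

lemma disjoint_join_meet:
  assumes "a \<sqinter> b = \<zero>" "x \<sqinter> y = \<zero>" and [simp]: "a \<in> A" "b \<in> A" "x \<in> A" "y \<in> A"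
  shows "(a \<squnion> x) \<sqinter> (b \<sqinter> y) = \<zero>"
  using disjoint_mono[OF assms(1), of a "b \<sqinter> y"] disjoint_mono[OF assms(2), of x "b \<sqinter> y"]
  by (simp add: distrib_right)

text \<open>By absorption and distributivity, \<open>x = x \<sqinter> (y \<squnion> z)\<close> and
  \<open>y = y \<sqinter> (x \<squnion> z)\<close>, and these two expand to the same join.\<close>

lemma lattice_cancel:
  assumes "x \<sqinter> z = y \<sqinter> z" "x \<squnion> z = y \<squnion> z" "x \<in> A" "y \<in> A" "z \<in> A"
  shows "x = y"
proof -
  have "x = x \<sqinter> (y \<squnion> z)"
    using assms by (simp add: meet_absorb flip: assms(2))
  also have "\<dots> = y \<sqinter> (x \<squnion> z)"
    using assms(1,3-) by (simp add: distrib meet_comm)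
  also have "\<dots> = y"
    using assms by (simp add: meet_absorb)
  finally show ?thesis .
qed

end

section \<open>Monotonicity of the implication and the disjointness of implication pairs\<close>

context dli_algebra
begin

declare imp_closed [simp] I3 [simp] I4 [simp]

lemma imp_mono_right: "\<lbrakk>x \<sqsubseteq> y; a \<in> A; x \<in> A; y \<in> A\<rbrakk> \<Longrightarrow> a \<leadsto> x \<sqsubseteq> a \<leadsto> y"
  by (metis I1 meet_le_def)

end

text \<open>Regrouping puts \<open>a\<close> next to \<open>a \<leadsto> x\<close>, so (I5) bounds
  that factor by \<open>x\<close>, while the other factor lies below \<open>y\<close>. This closes
  the twist carrier under implication.\<close>

lemma (in dli_plus_algebra) imp_pair_disjoint:
  assumes "x \<sqinter> y = \<zero>" and [simp]: "a \<in> A" "b \<in> A" "x \<in> A" "y \<in> A"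
  shows "((a \<leadsto> x) \<sqinter> (y \<leadsto> b)) \<sqinter> (a \<sqinter> y) = \<zero>"
proof -
  have "((a \<leadsto> x) \<sqinter> (y \<leadsto> b)) \<sqinter> (a \<sqinter> y) = (a \<sqinter> (a \<leadsto> x)) \<sqinter> ((y \<leadsto> b) \<sqinter> y)"
    by (simp add: meet_ac)
  also have "\<dots> = \<zero>"
    by (rule disjoint_mono[OF assms(1)]) (simp_all add: I5)
  finally show ?thesis .
qed

section \<open>Consequences of the two adjunctions: \<open>P\<close> is left adjoint to
  \<open>G\<close>, and \<open>F\<close> to \<open>H\<close>\<close>

context tense_dli_plus_algebra
begin

declare G_closed [simp] H_closed [simp] F_closed [simp] P_closed [simp]

text \<open>Units and counits of the adjunctions, obtained by transposing reflexivity.\<close>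

lemma le_G_P: "x \<in> A \<Longrightarrow> x \<sqsubseteq> G (P x)" and le_H_F: "x \<in> A \<Longrightarrow> x \<sqsubseteq> H (F x)"
  and P_G_le: "x \<in> A \<Longrightarrow> P (G x) \<sqsubseteq> x" and F_H_le: "x \<in> A \<Longrightarrow> F (H x) \<sqsubseteq> x"
  using T1[of x "P x"] T1[of "G x" x] T2[of x "F x"] T2[of "H x" x] by simp_all

lemma P_mono: "\<lbrakk>x \<sqsubseteq> y; x \<in> A; y \<in> A\<rbrakk> \<Longrightarrow> P x \<sqsubseteq> P y"
  using le_trans[OF _ le_G_P, of x y] by (simp add: T1)

lemma F_mono: "\<lbrakk>x \<sqsubseteq> y; x \<in> A; y \<in> A\<rbrakk> \<Longrightarrow> F x \<sqsubseteq> F y"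
  using le_trans[OF _ le_H_F, of x y] by (simp add: T2)

lemma G_mono: "\<lbrakk>x \<sqsubseteq> y; x \<in> A; y \<in> A\<rbrakk> \<Longrightarrow> G x \<sqsubseteq> G y"
  using le_trans[OF P_G_le, of x y] by (simp flip: T1)

lemma H_mono: "\<lbrakk>x \<sqsubseteq> y; x \<in> A; y \<in> A\<rbrakk> \<Longrightarrow> H x \<sqsubseteq> H y"
  using le_trans[OF F_H_le, of x y] by (simp flip: T2)

lemma G_one [simp]: "G \<one> = \<one>" and H_one [simp]: "H \<one> = \<one>"
  using T1[of \<one> \<one>] T2[of \<one> \<one>] by (simp_all add: le_antisym)

lemma P_zero [simp]: "P \<zero> = \<zero>" and F_zero [simp]: "F \<zero> = \<zero>"
  using T1[of \<zero> \<zero>] T2[of \<zero> \<zero>] by simp_all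

text \<open>Right adjoints preserve meets: the hard inequality is transposed to one about
  \<open>P\<close>, where both bounds are counits.\<close>

lemma G_meet: "\<lbrakk>x \<in> A; y \<in> A\<rbrakk> \<Longrightarrow> G (x \<sqinter> y) = G x \<sqinter> G y"
proof (rule le_antisym)
  assume [simp]: "x \<in> A" "y \<in> A"
  have "P (G x \<sqinter> G y) \<sqsubseteq> x \<sqinter> y"
    by (simp add: le_meet_iff T1)
  then show "G x \<sqinter> G y \<sqsubseteq> G (x \<sqinter> y)"
    by (simp add: T1)
qed (simp_all add: le_meet_iff G_mono)

lemma H_meet: "\<lbrakk>x \<in> A; y \<in> A\<rbrakk> \<Longrightarrow> H (x \<sqinter> y) = H x \<sqinter> H y"
proof (rule le_antisym)
  assume [simp]: "x \<in> A" "y \<in> A"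
  have "F (H x \<sqinter> H y) \<sqsubseteq> x \<sqinter> y"
    by (simp add: le_meet_iff T2)
  then show "H x \<sqinter> H y \<sqsubseteq> H (x \<sqinter> y)"
    by (simp add: T2)
qed (simp_all add: le_meet_iff H_mono)

lemma P_join: "\<lbrakk>x \<in> A; y \<in> A\<rbrakk> \<Longrightarrow> P (x \<squnion> y) = P x \<squnion> P y"
proof (rule le_antisym)
  assume [simp]: "x \<in> A" "y \<in> A"
  have "x \<sqsubseteq> G (P x \<squnion> P y)" "y \<sqsubseteq> G (P x \<squnion> P y)"
    by (simp_all flip: T1)
  then show "P (x \<squnion> y) \<sqsubseteq> P x \<squnion> P y"
    by (simp add: T1 join_le_iff)
qed (simp_all add: join_le_iff P_mono)

lemma F_join: "\<lbrakk>x \<in> A; y \<in> A\<rbrakk> \<Longrightarrow> F (x \<squnion> y) = F x \<squnion> F y"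
proof (rule le_antisym)
  assume [simp]: "x \<in> A" "y \<in> A"
  have "x \<sqsubseteq> H (F x \<squnion> F y)" "y \<sqsubseteq> H (F x \<squnion> F y)"
    by (simp_all flip: T2)
  then show "F (x \<squnion> y) \<sqsubseteq> F x \<squnion> F y"
    by (simp add: T2 join_le_iff)
qed (simp_all add: join_le_iff F_mono)

text \<open>The order of factors in which (T3) occurs in the second coordinate of (t4) and (t6) for
  pairs.\<close>

lemma T3_G': "\<lbrakk>x \<in> A; y \<in> A\<rbrakk> \<Longrightarrow> F x \<sqinter> G y \<sqsubseteq> F (x \<sqinter> y)"
  and T3_H': "\<lbrakk>x \<in> A; y \<in> A\<rbrakk> \<Longrightarrow> P x \<sqinter> H y \<sqsubseteq> P (x \<sqinter> y)"
  using T3_G[of y x] T3_H[of y x] by (simp_all add: meet_comm)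

end

section \<open>Centered Kleene algebras and KI-algebras\<close>

context centered_kleene_algebra
begin

declare neg_closed [simp] center_closed [simp] neg_neg [simp] neg_center [simp]

lemma neg_meet: "\<lbrakk>x \<in> A; y \<in> A\<rbrakk> \<Longrightarrow> \<sim> (x \<sqinter> y) = \<sim> x \<squnion> \<sim> y"
  using neg_join[of "\<sim> x" "\<sim> y"] by (metis join_closed neg_closed neg_neg)

lemma neg_antimono: "\<lbrakk>x \<sqsubseteq> y; x \<in> A; y \<in> A\<rbrakk> \<Longrightarrow> \<sim> y \<sqsubseteq> \<sim> x"
  by (metis le_iff_join meet_lower1 neg_closed neg_join)

lemma neg_le_iff: "\<lbrakk>x \<in> A; y \<in> A\<rbrakk> \<Longrightarrow> \<sim> x \<sqsubseteq> y \<longleftrightarrow> \<sim> y \<sqsubseteq> x"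
  by (metis neg_antimono neg_closed neg_neg)

lemma neg_zero: "\<sim> \<zero> = \<one>"
  by (metis join_comm neg_closed neg_join neg_neg one_closed one_meet(2) zero_closed zero_join(1))

lemma neg_one: "\<sim> \<one> = \<zero>"
  by (metis neg_neg neg_zero zero_closed)

text \<open>The Kleene inequality taken at \<open>c\<close>, whose join with its own negation is
  \<open>c\<close>.\<close>

lemma meet_neg_le_center: "x \<in> A \<Longrightarrow> x \<sqinter> \<sim> x \<sqsubseteq> c"
  using kleene[of x c] by simp

text \<open>Distributivity turns the left side into the join of \<open>x \<sqinter> \<sim> x\<close>
  with \<open>c\<close>. As \<open>c\<close> is the bottom of the upset, the values of
  \<open>beta\<close> are disjoint pairs there.\<close>

lemma center_pair_disjoint: "x \<in> A \<Longrightarrow> (x \<squnion> c) \<sqinter> (\<sim> x \<squnion> c) = c"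
  using meet_neg_le_center[of x] by (simp add: le_iff_join flip: join_distrib_right)

lemma join_center_meet: "\<lbrakk>x \<in> A; y \<in> A\<rbrakk> \<Longrightarrow> (x \<sqinter> y) \<squnion> c = (x \<squnion> c) \<sqinter> (y \<squnion> c)"
  by (simp add: join_distrib_right)

lemma join_center_join: "\<lbrakk>x \<in> A; y \<in> A\<rbrakk> \<Longrightarrow> (x \<squnion> y) \<squnion> c = (x \<squnion> c) \<squnion> (y \<squnion> c)"
  by (metis center_closed join_assoc join_closed join_comm join_idem)

text \<open>Injectivity of \<open>beta\<close>: negating the second hypothesis gives equal meets
  with \<open>c\<close>, the first gives equal joins, and cancellation applies.\<close>

lemma center_pair_inject:
  assumes "x \<squnion> c = y \<squnion> c" "\<sim> x \<squnion> c = \<sim> y \<squnion> c" and [simp]: "x \<in> A" "y \<in> A"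
  shows "x = y"
proof (rule lattice_cancel[of x c y])
  have "x \<sqinter> c = \<sim> (\<sim> x \<squnion> c)" "y \<sqinter> c = \<sim> (\<sim> y \<squnion> c)"
    by (simp_all add: neg_join)
  then show "x \<sqinter> c = y \<sqinter> c"
    by (simp add: assms)
qed (simp_all add: assms)

end

section \<open>Implication above the center, and the coordinates of an implication under
  \<open>beta\<close>\<close>

context ki_algebra
begin

lemma center_imp [simp]:
  assumes "x \<in> A" "c \<sqsubseteq> x" shows "c \<leadsto> x = \<one>"
  using imp_mono_right[of c x c] assms KI3 by (simp add: meet_le_def)

text \<open>(KI4) computes the part of an implication below \<open>c\<close>; when
  \<open>c \<sqsubseteq> y\<close> that part is all of \<open>c\<close>.\<close>

lemma center_le_imp:
  assumes "x \<in> A" "y \<in> A" "c \<sqsubseteq> y" shows "c \<sqsubseteq> x \<leadsto> y"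
proof -
  have "c \<sqsubseteq> \<sim> x \<squnion> y"
    using assms le_trans[OF assms(3) join_upper2] by simp
  then have "(x \<leadsto> y) \<sqinter> c = c"
    using assms by (simp add: KI4) (simp add: meet_le_def meet_comm)
  then show ?thesis
    using assms by (simp add: meet_le_def meet_comm)
qed

text \<open>(KI5) at \<open>x\<close> and \<open>\<sim> y\<close>. Joining \<open>c\<close> to the
  antecedents changes nothing: (I2) splits off an implication from \<open>c\<close> to an element
  above \<open>c\<close>, which is \<open>\<one>\<close>. The right side is the first coordinate of
  an implication of pairs.\<close>

lemma join_center_imp:
  assumes [simp]: "x \<in> A" "y \<in> A"
  shows "(x \<leadsto> y) \<squnion> c = ((x \<squnion> c) \<leadsto> (y \<squnion> c)) \<sqinter> ((\<sim> y \<squnion> c) \<leadsto> (\<sim> x \<squnion> c))"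
  using KI5[of x "\<sim> y"] by (simp flip: I2)

text \<open>Since \<open>c\<close> is its own negation, the left side is the negation of a meet with
  \<open>c\<close>, which (KI4) computes. The right side is the second coordinate of an implication
  of pairs.\<close>

lemma join_center_neg_imp:
  assumes [simp]: "x \<in> A" "y \<in> A"
  shows "\<sim> (x \<leadsto> y) \<squnion> c = (x \<squnion> c) \<sqinter> (\<sim> y \<squnion> c)"
proof -
  have "\<sim> (x \<leadsto> y) \<squnion> c = \<sim> ((\<sim> x \<squnion> y) \<sqinter> c)"
    by (simp add: neg_meet flip: KI4)
  then show ?thesis
    by (simp add: neg_meet neg_join join_center_meet)
qed

end

section \<open>The De Morgan dual operators and their adjunctions\<close>

context tense_ki_algebra
begin

declare G_closed [simp] H_closed [simp]

lemma F_closed [simp]: "x \<in> A \<Longrightarrow> F x \<in> A" and P_closed [simp]: "x \<in> A \<Longrightarrow> P x \<in> A"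
  by (simp_all add: dual_op_def)

lemma neg_G: "x \<in> A \<Longrightarrow> \<sim> (G x) = F (\<sim> x)" and neg_H: "x \<in> A \<Longrightarrow> \<sim> (H x) = P (\<sim> x)"
  by (simp_all add: dual_op_def)

lemma neg_F: "x \<in> A \<Longrightarrow> \<sim> (F x) = G (\<sim> x)" and neg_P: "x \<in> A \<Longrightarrow> \<sim> (P x) = H (\<sim> x)"
  by (simp_all add: dual_op_def)

lemma G_mono: "\<lbrakk>x \<sqsubseteq> y; x \<in> A; y \<in> A\<rbrakk> \<Longrightarrow> G x \<sqsubseteq> G y"
  and H_mono: "\<lbrakk>x \<sqsubseteq> y; x \<in> A; y \<in> A\<rbrakk> \<Longrightarrow> H x \<sqsubseteq> H y"
  by (metis meet_le_def t2_G, metis meet_le_def t2_H)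

lemma F_mono: "\<lbrakk>x \<sqsubseteq> y; x \<in> A; y \<in> A\<rbrakk> \<Longrightarrow> F x \<sqsubseteq> F y"
  and P_mono: "\<lbrakk>x \<sqsubseteq> y; x \<in> A; y \<in> A\<rbrakk> \<Longrightarrow> P x \<sqsubseteq> P y"
  by (simp_all add: dual_op_def neg_antimono G_mono H_mono)

text \<open>The counit is the negation of (t3) for the other pair of operators, taken at
  \<open>\<sim> x\<close>.\<close>

lemma P_G_le: "x \<in> A \<Longrightarrow> P (G x) \<sqsubseteq> x"
  using t3_H[of "\<sim> x"] by (simp add: dual_op_def neg_le_iff)

lemma F_H_le: "x \<in> A \<Longrightarrow> F (H x) \<sqsubseteq> x"
  using t3_G[of "\<sim> x"] by (simp add: dual_op_def neg_le_iff)

lemma P_le_iff: "\<lbrakk>x \<in> A; y \<in> A\<rbrakk> \<Longrightarrow> P x \<sqsubseteq> y \<longleftrightarrow> x \<sqsubseteq> G y"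
  using le_trans[OF t3_G G_mono, of x y] le_trans[OF P_mono P_G_le, of x y] by auto

lemma F_le_iff: "\<lbrakk>x \<in> A; y \<in> A\<rbrakk> \<Longrightarrow> F x \<sqsubseteq> y \<longleftrightarrow> x \<sqsubseteq> H y"
  using le_trans[OF t3_H H_mono, of x y] le_trans[OF F_mono F_H_le, of x y] by auto

text \<open>(T3) is the De Morgan dual of (t4): negating (t4) at \<open>\<sim> y\<close> and
  \<open>\<sim> x\<close> exchanges \<open>G\<close> with \<open>F\<close> and join with
  meet.\<close>

lemma G_meet_F_le: "\<lbrakk>x \<in> A; y \<in> A\<rbrakk> \<Longrightarrow> G x \<sqinter> F y \<sqsubseteq> F (x \<sqinter> y)"
  using neg_antimono[OF t4_G[of "\<sim> y" "\<sim> x"]]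
  by (simp add: neg_join neg_G neg_F meet_comm join_comm flip: neg_meet)

lemma H_meet_P_le: "\<lbrakk>x \<in> A; y \<in> A\<rbrakk> \<Longrightarrow> H x \<sqinter> P y \<sqsubseteq> P (x \<sqinter> y)"
  using neg_antimono[OF t4_H[of "\<sim> y" "\<sim> x"]]
  by (simp add: neg_join neg_H neg_P meet_comm join_comm flip: neg_meet)

end

section \<open>The upset of the center as an algebra, and the tense operators under
  \<open>beta\<close>\<close>

context tense_centered_ki_algebra
begin

lemma F_center [simp]: "F c = c" and P_center [simp]: "P c = c"
  by (simp_all add: dual_op_def G_center H_center)

text \<open>All four operators are monotone and fix \<open>c\<close>.\<close>

lemma center_le_ops:
  assumes "x \<in> A" "c \<sqsubseteq> x"
  shows "c \<sqsubseteq> G x" "c \<sqsubseteq> H x" "c \<sqsubseteq> F x" "c \<sqsubseteq> P x"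
  using G_mono[of c x] H_mono[of c x] F_mono[of c x] P_mono[of c x] assms
  by (simp_all add: G_center H_center)

lemma upset_of_center:
  "tense_dli_plus_algebra_0 {x \<in> A. c \<sqsubseteq> x} (\<sqinter>) (\<squnion>) c \<one> (\<leadsto>) G H F P"
proof unfold_locales
  fix x y assume "x \<in> {x \<in> A. c \<sqsubseteq> x}" "y \<in> {x \<in> A. c \<sqsubseteq> x}"
  then have *: "x \<in> A" "y \<in> A" "c \<sqsubseteq> x" "c \<sqsubseteq> y" by auto
  \<comment> \<open>Joining with \<open>c\<close> leaves \<open>y\<close> unchanged, so (KI2)
    becomes (I5).\<close>
  show "x \<sqinter> (x \<leadsto> y) \<sqsubseteq> y"
    using KI2[of x y] * by (simp add: join_le_iff le_iff_join[of c y] join_comm[of _ c])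
  show "x \<squnion> y \<in> {x \<in> A. c \<sqsubseteq> x}"
    using * le_trans[OF _ join_upper1, of c x y] by simp
qed (auto simp: le_meet_iff meet_ac join_ac meet_absorb join_absorb distrib center_le_imp
   I1 I2 center_le_ops P_le_iff F_le_iff G_meet_F_le H_meet_P_le t4_G t4_H t5_G t5_H t6_G t6_H
   G_center H_center)

lemma G_join_center: "x \<in> A \<Longrightarrow> G (x \<squnion> c) = G x \<squnion> c"
  using t4_G[of x c] G_mono[of x "x \<squnion> c"] G_mono[of c "x \<squnion> c"]
  by (intro le_antisym) (simp_all add: join_le_iff G_center)

lemma H_join_center: "x \<in> A \<Longrightarrow> H (x \<squnion> c) = H x \<squnion> c"
  using t4_H[of x c] H_mono[of x "x \<squnion> c"] H_mono[of c "x \<squnion> c"]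
  by (intro le_antisym) (simp_all add: join_le_iff H_center)

text \<open>By De Morgan, \<open>F (\<sim> x \<squnion> c)\<close> is the negation of
  \<open>G (x \<sqinter> c)\<close>, and (t2) with \<open>G c = c\<close> splits that. This handles
  the second coordinate of \<open>beta\<close>.\<close>

lemma F_neg_join_center: "x \<in> A \<Longrightarrow> F (\<sim> x \<squnion> c) = \<sim> (G x) \<squnion> c"
  and P_neg_join_center: "x \<in> A \<Longrightarrow> P (\<sim> x \<squnion> c) = \<sim> (H x) \<squnion> c"
  by (simp_all add: dual_op_def neg_join t2_G t2_H G_center H_center neg_meet)

end

section \<open>The twist construction\<close>

locale tdli0_object =
  fixes L :: "'a tdli"
  assumes object: "L \<in> tdli0_objects"

sublocale tdli0_object \<subseteq> tense_dli_plus_algebra_0 "carrier L" "meet_of L" "join_of L"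
  "zero_of L" "one_of L" "imp_of L" "G_of L" "H_of L" "F_of L" "P_of L"
  using object by (simp add: tdli0_objects_def)

lemma K_mem: "Pair a b \<in> carrier (K_obj L) \<longleftrightarrow>
    a \<in> carrier L \<and> b \<in> carrier L \<and> meet_of L a b = zero_of L"
  by (simp add: K_obj_def)

lemma K_elim:
  assumes "u \<in> carrier (K_obj L)"
  obtains a b where "u = Pair a b" "a \<in> carrier L" "b \<in> carrier L" "meet_of L a b = zero_of L"
  using assms by (auto simp: K_obj_def)

text \<open>In the last two equations, dualizing swaps the coordinates before and after the
  operator, so \<open>F\<close> and \<open>G\<close> (or \<open>P\<close> and \<open>H\<close>)
  trade places.\<close>

lemma K_simps:
  "meet_of (K_obj L) (Pair a b) (Pair x y) = Pair (meet_of L a x) (join_of L b y)"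
  "join_of (K_obj L) (Pair a b) (Pair x y) = Pair (join_of L a x) (meet_of L b y)"
  "imp_of (K_obj L) (Pair a b) (Pair x y) =
     Pair (meet_of L (imp_of L a x) (imp_of L y b)) (meet_of L a y)"
  "zero_of (K_obj L) = Pair (zero_of L) (one_of L)"
  "one_of (K_obj L) = Pair (one_of L) (zero_of L)"
  "G_of (K_obj L) (Pair a b) = Pair (G_of L a) (F_of L b)"
  "H_of (K_obj L) (Pair a b) = Pair (H_of L a) (P_of L b)"
  "neg_of (K_obj L) (Pair a b) = Pair b a"
  "center_of (K_obj L) = Pair (zero_of L) (zero_of L)"
  "dual_op (neg_of (K_obj L)) (G_of (K_obj L)) (Pair a b) = Pair (F_of L a) (G_of L b)"
  "dual_op (neg_of (K_obj L)) (H_of (K_obj L)) (Pair a b) = Pair (P_of L a) (H_of L b)"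
  by (simp_all add: K_obj_def dual_op_def)

text \<open>The carrier type is specialized to \<open>'a univ\<close>, in which pairs of elements
  are again elements.\<close>

locale univ_tdli0_object = tdli0_object L for L :: "'a univ tdli"

notation (in univ_tdli0_object) le (infix "\<sqsubseteq>" 50)

context univ_tdli0_object
begin

text \<open>The second coordinate carries the reversed order, because a meet of pairs joins second
  coordinates.\<close>

lemma K_le:
  "\<lbrakk>a \<in> carrier L; b \<in> carrier L; x \<in> carrier L; y \<in> carrier L\<rbrakk> \<Longrightarrow>
     meet_le (meet_of (K_obj L)) (Pair a b) (Pair x y) \<longleftrightarrow> a \<sqsubseteq> x \<and> y \<sqsubseteq> b"
  by (auto simp: K_simps meet_le_def[of _ "Pair a b"] meet_le_def[of _ a x] le_iff_join join_comm)

lemma K_bounded_dlattice: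
  "bounded_dlattice (carrier (K_obj L)) (meet_of (K_obj L)) (join_of (K_obj L))
     (zero_of (K_obj L)) (one_of (K_obj L))"
proof ((unfold_locales; (elim K_elim)?), goal_cases)
  case (1 u v a b x y)
  then show ?case
    using disjoint_join_meet[of b a y x] by (simp add: K_mem K_simps meet_comm)
next
  case (2 u v a b x y)
  then show ?case
    using disjoint_join_meet[of a b x y] by (simp add: K_mem K_simps)
next
  \<comment> \<open>The first coordinate needs the distributive law and the second its dual.\<close>
  case (11 u v w)
  then show ?case
    by (auto simp: K_simps intro: distrib join_distrib)
qed (simp_all add: K_mem K_simps K_le meet_ac join_ac meet_absorb join_absorb)

text \<open>Disjointness gives the Kleene inequality: a pair met with its negation has first
  coordinate zero, a pair joined with its negation has second coordinate zero, so the center lies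
  between.\<close>

lemma K_kleene:
  "centered_kleene_algebra (carrier (K_obj L)) (meet_of (K_obj L)) (join_of (K_obj L))
     (zero_of (K_obj L)) (one_of (K_obj L)) (neg_of (K_obj L)) (center_of (K_obj L))"
proof -
  interpret K: bounded_dlattice "carrier (K_obj L)" "meet_of (K_obj L)" "join_of (K_obj L)"
    "zero_of (K_obj L)" "one_of (K_obj L)"
    by (rule K_bounded_dlattice)
  show ?thesis
    by (unfold_locales; (elim K_elim)?; simp add: K_mem K_simps K_le meet_comm)
qed

text \<open>In the first coordinate (I1) and (I2) of \<open>L\<close> act together, one on each of
  the two implications; in the second coordinate only distributivity remains.\<close>

lemma K_dli:
  "dli_algebra (carrier (K_obj L)) (meet_of (K_obj L)) (join_of (K_obj L))
     (zero_of (K_obj L)) (one_of (K_obj L)) (imp_of (K_obj L))"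
proof -
  interpret K: bounded_dlattice "carrier (K_obj L)" "meet_of (K_obj L)" "join_of (K_obj L)"
    "zero_of (K_obj L)" "one_of (K_obj L)"
    by (rule K_bounded_dlattice)
  show ?thesis
    by (unfold_locales; (elim K_elim)?;
        simp add: K_mem K_simps K_le imp_pair_disjoint;
        simp add: distrib distrib_right meet_ac flip: I1 I2)
qed

text \<open>Joining with the center erases the second coordinate and meeting with it erases the
  first, so (KI2) and (KI5) concern first coordinates only and (KI4) second coordinates
  only.\<close>

lemma K_ki:
  "ki_algebra (carrier (K_obj L)) (meet_of (K_obj L)) (join_of (K_obj L))
     (zero_of (K_obj L)) (one_of (K_obj L)) (neg_of (K_obj L)) (center_of (K_obj L))
     (imp_of (K_obj L))"
proof -
  interpret K: centered_kleene_algebra "carrier (K_obj L)" "meet_of (K_obj L)" "join_of (K_obj L)"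
    "zero_of (K_obj L)" "one_of (K_obj L)" "neg_of (K_obj L)" "center_of (K_obj L)"
    by (rule K_kleene)
  interpret K: dli_algebra "carrier (K_obj L)" "meet_of (K_obj L)" "join_of (K_obj L)"
    "zero_of (K_obj L)" "one_of (K_obj L)" "imp_of (K_obj L)"
    by (rule K_dli)
  \<comment> \<open>(I5) with an extra factor \<open>w\<close>: the first coordinate of an
    implication of pairs contains a second implication besides \<open>imp_of L a x\<close>.\<close>
  have modus_ponens: "meet_of L a (meet_of L (imp_of L a x) w) \<sqsubseteq> x"
    if "a \<in> carrier L" "x \<in> carrier L" "w \<in> carrier L" for a x w
    using that le_trans[OF meet_lower1 I5, of a x w] by (simp add: meet_assoc)
  show ?thesis
    by (unfold_locales; (elim K_elim)?; simp add: K_mem K_simps K_le modus_ponens)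
qed

lemma K_object: "K_obj L \<in> itki_objects"
proof -
  interpret K: ki_algebra "carrier (K_obj L)" "meet_of (K_obj L)" "join_of (K_obj L)"
    "zero_of (K_obj L)" "one_of (K_obj L)" "neg_of (K_obj L)" "center_of (K_obj L)"
    "imp_of (K_obj L)"
    by (rule K_ki)
  \<comment> \<open>By (T3) the meet lies below \<open>F\<close> or \<open>P\<close> of zero, which
    is zero by adjointness.\<close>
  have disjoint_GF: "meet_of L (G_of L a) (F_of L b) = zero_of L"
    and disjoint_HP: "meet_of L (H_of L a) (P_of L b) = zero_of L"
    if "a \<in> carrier L" "b \<in> carrier L" "meet_of L a b = zero_of L" for a b
    using that T3_G[of a b] T3_H[of a b] by simp_all
  \<comment> \<open>The first coordinate of (t5), and likewise of (t6), uses (T5) for one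
    implication and (T6) for the other; the second coordinate is (T3).\<close>
  note tense = T3_G T3_H T3_G' T3_H' T4_G T4_H G_meet H_meet F_join P_join
    G_zero H_zero le_G_P le_H_F P_G_le F_H_le
  have "tense_centered_ki_algebra_CK (carrier (K_obj L)) (meet_of (K_obj L)) (join_of (K_obj L))
     (zero_of (K_obj L)) (one_of (K_obj L)) (neg_of (K_obj L)) (center_of (K_obj L))
     (imp_of (K_obj L)) (G_of (K_obj L)) (H_of (K_obj L))"
  proof ((unfold_locales; (elim K_elim)?), goal_cases)
    \<comment> \<open>For (CK), lying above the center forces \<open>b\<close> and \<open>b'\<close>
      to be zero, and the bound on the meet makes \<open>a\<close> and \<open>a'\<close> disjoint,
      so \<open>Pair a a'\<close> is the required element.\<close>
    case (17 x y a b a' b')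
    then show ?case
      by (intro bexI[of _ "Pair a a'"]) (simp_all add: K_mem K_simps K_le)
  qed (simp_all add: K_mem K_simps K_le disjoint_GF disjoint_HP tense
         meet_mono T5_G T5_H T6_G T6_H)
  then show ?thesis
    by (simp add: itki_objects_def)
qed

end

section \<open>Categories of algebras\<close>

lemma cat_functor_id: "category C \<Longrightarrow> cat_functor C C id_functor"
  by (simp add: cat_functor_def cat_functor_axioms_def id_functor_def)

lemma cat_functor_comp:
  assumes "cat_functor C D \<Phi>" "cat_functor D E \<Psi>"
  shows "cat_functor C E (comp_functor \<Psi> \<Phi>)"
proof -
  interpret \<Phi>: cat_functor C D \<Phi> by fact
  interpret \<Psi>: cat_functor D E \<Psi> by fact
  show ?thesis
    by unfold_locales
      (simp_all add: comp_functor_def \<Phi>.omap_obj \<Phi>.amap_arr \<Phi>.amap_dom \<Phi>.amap_cod \<Phi>.amap_ide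
        \<Phi>.amap_comp
        \<Psi>.omap_obj \<Psi>.amap_arr \<Psi>.amap_dom \<Psi>.amap_cod \<Psi>.amap_ide \<Psi>.amap_comp)
qed

lemma algebra_category_simps [simp]:
  "Obj (algebra_category objs homs) = objs"
  "(L, f, M) \<in> Arr (algebra_category objs homs) \<longleftrightarrow> L \<in> objs \<and> M \<in> objs \<and> f \<in> homs L M"
  "Dom (algebra_category objs homs) (L, f, M) = L"
  "Cod (algebra_category objs homs) (L, f, M) = M"
  "Ide (algebra_category objs homs) L = (L, \<lambda>x \<in> carrier L. x, L)"
  "Comp (algebra_category objs homs) (M', g, N) (L, f, M) = (L, compose (carrier L) g f, N)"
  by (simp_all add: algebra_category_def)

text \<open>Extensionality turns the unit laws into equalities of functions: off the carrier both
  sides are \<open>undefined\<close>. Associativity uses that arrows map carrier into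
  carrier.\<close>

lemma category_algebra_category:
  assumes ext: "\<And>L M f. f \<in> homs L M \<Longrightarrow> f \<in> carrier L \<rightarrow>\<^sub>E carrier M"
    and ide: "\<And>L. L \<in> objs \<Longrightarrow> (\<lambda>x \<in> carrier L. x) \<in> homs L L"
    and comp: "\<And>L M N f g. \<lbrakk>L \<in> objs; f \<in> homs L M; g \<in> homs M N\<rbrakk>
      \<Longrightarrow> compose (carrier L) g f \<in> homs L N"
  shows "category (algebra_category objs homs)"
proof -
  have unit: "compose (carrier L) f (\<lambda>x\<in>carrier L. x) = f" "compose (carrier L) (\<lambda>x\<in>carrier M. x) f = f"
    if "f \<in> homs L M" for f L M
    using ext[OF that] by (auto simp: compose_def PiE_def extensional_def Pi_def fun_eq_iff)
  have assoc: "compose (carrier K) h (compose (carrier K) g f) =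
      compose (carrier K) (compose (carrier L) h g) f"
    if "f \<in> homs K L" for f g h K L
    by (rule compose_assoc) (use ext[OF that] in auto)
  show ?thesis
    by (unfold_locales; (simp only: split_paired_all)?; auto simp: ide comp unit intro: assoc)
qed

lemma iso_arr_algebra_category:
  assumes "(L, f, M) \<in> Arr (algebra_category objs homs)"
    and bij: "bij_betw f (carrier L) (carrier M)"
    and inv: "restrict (inv_into (carrier L) f) (carrier M) \<in> homs M L"
  shows "iso_arr (algebra_category objs homs) (L, f, M)"
proof -
  have "compose (carrier L) (restrict (inv_into (carrier L) f) (carrier M)) f = (\<lambda>x\<in>carrier L. x)"
    "compose (carrier M) f (restrict (inv_into (carrier L) f) (carrier M)) = (\<lambda>x\<in>carrier M. x)"
    using bij by (auto simp: compose_def fun_eq_iff bij_betw_def f_inv_into_f)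
  then show ?thesis
    unfolding iso_arr_def using assms
    by (auto intro!: bexI[of _ "(M, restrict (inv_into (carrier L) f) (carrier M), L)"])
qed

text \<open>Collects closure under the operations common to both signatures, so that identities,
  composites and inverses are treated once for both categories.\<close>

definition ops_closed :: "('a, 'r) tense_sig_scheme \<Rightarrow> bool" where
  "ops_closed L \<longleftrightarrow>
     (\<forall>x \<in> carrier L. \<forall>y \<in> carrier L.
        meet_of L x y \<in> carrier L \<and> join_of L x y \<in> carrier L \<and> imp_of L x y \<in> carrier L) \<and>
     (\<forall>x \<in> carrier L. G_of L x \<in> carrier L \<and> H_of L x \<in> carrier L) \<and>
     zero_of L \<in> carrier L \<and> one_of L \<in> carrier L"

lemma preserves_op1_inv:
  assumes bij: "bij_betw f A B" and pres: "preserves_op1 A f u v" and closed: "\<And>x. x \<in> A \<Longrightarrow> u x \<in> A"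
  shows "preserves_op1 B (restrict (inv_into A f) B) v u"
  unfolding preserves_op1_def
proof
  fix y assume "y \<in> B"
  then obtain x where "x \<in> A" "y = f x" using bij by (auto simp: bij_betw_def)
  moreover have "v (f x) = f (u x)"
    using \<open>x \<in> A\<close> pres by (simp add: preserves_op1_def)
  moreover have "f (u x) \<in> B"
    using \<open>x \<in> A\<close> closed bij_betw_apply[OF bij] by simp
  ultimately show "restrict (inv_into A f) B (v y) = u (restrict (inv_into A f) B y)"
    using \<open>y \<in> B\<close> bij closed by (simp add: bij_betw_def)
qed

lemma preserves_op2_inv:
  assumes bij: "bij_betw f A B" and pres: "preserves_op2 A f u v"
    and closed: "\<And>x y. \<lbrakk>x \<in> A; y \<in> A\<rbrakk> \<Longrightarrow> u x y \<in> A"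
  shows "preserves_op2 B (restrict (inv_into A f) B) v u"
  unfolding preserves_op2_def
proof (intro ballI)
  fix y y' assume "y \<in> B" "y' \<in> B"
  then obtain x x' where "x \<in> A" "y = f x" "x' \<in> A" "y' = f x'"
    using bij by (auto simp: bij_betw_def)
  moreover have "v (f x) (f x') = f (u x x')"
    using \<open>x \<in> A\<close> \<open>x' \<in> A\<close> pres by (simp add: preserves_op2_def)
  moreover have "f (u x x') \<in> B"
    using \<open>x \<in> A\<close> \<open>x' \<in> A\<close> closed bij_betw_apply[OF bij] by simp
  ultimately show "restrict (inv_into A f) B (v y y') =
      u (restrict (inv_into A f) B y) (restrict (inv_into A f) B y')"
    using \<open>y \<in> B\<close> \<open>y' \<in> B\<close> bij closed by (simp add: bij_betw_def)
qed

lemma tense_sig_hom_id: "ops_closed L \<Longrightarrow> (\<lambda>x \<in> carrier L. x) \<in> tense_sig_hom L L"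
  by (simp add: tense_sig_hom_def ops_closed_def preserves_op1_def preserves_op2_def)

lemma tense_sig_hom_compose:
  "\<lbrakk>ops_closed L; f \<in> tense_sig_hom L M; g \<in> tense_sig_hom M N\<rbrakk>
     \<Longrightarrow> compose (carrier L) g f \<in> tense_sig_hom L N"
  by (auto simp: tense_sig_hom_def ops_closed_def preserves_op1_def preserves_op2_def compose_def PiE_iff)

text \<open>The inverse of a bijective homomorphism is a homomorphism: operations transfer by
  \<open>preserves_op1_inv\<close> and \<open>preserves_op2_inv\<close>, constants by
  injectivity.\<close>

lemma tense_sig_hom_inv:
  assumes "ops_closed L" "f \<in> tense_sig_hom L M" "bij_betw f (carrier L) (carrier M)"
  shows "restrict (inv_into (carrier L) f) (carrier M) \<in> tense_sig_hom M L"
proof -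
  have "inv_into (carrier L) f (zero_of M) = zero_of L" "inv_into (carrier L) f (one_of M) = one_of L"
    "zero_of M \<in> carrier M" "one_of M \<in> carrier M"
    using assms inv_into_f_f[of f "carrier L" "zero_of L"] inv_into_f_f[of f "carrier L" "one_of L"]
    by (auto simp: tense_sig_hom_def ops_closed_def bij_betw_def PiE_iff)
  then show ?thesis
    using assms by (auto simp: tense_sig_hom_def ops_closed_def bij_betw_def inv_into_into
      intro!: preserves_op1_inv preserves_op2_inv)
qed

section \<open>The two concrete categories and their isomorphisms\<close>

lemma ops_closed_tdli0: "L \<in> tdli0_objects \<Longrightarrow> ops_closed L"
proof -
  assume "L \<in> tdli0_objects"
  then interpret tdli0_object L by unfold_locales
  show ?thesis by (simp add: ops_closed_def)
qed

locale itki_object =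
  fixes U :: "'a tki"
  assumes object: "U \<in> itki_objects"

sublocale itki_object \<subseteq> tense_centered_ki_algebra_CK "carrier U" "meet_of U" "join_of U"
  "zero_of U" "one_of U" "neg_of U" "center_of U" "imp_of U" "G_of U" "H_of U"
  using object by (simp add: itki_objects_def)

lemma ops_closed_itki: "U \<in> itki_objects \<Longrightarrow> ops_closed U"
proof -
  assume "U \<in> itki_objects"
  then interpret itki_object U by unfold_locales
  show ?thesis by (simp add: ops_closed_def)
qed

lemma tdli_hom_id: "L \<in> tdli0_objects \<Longrightarrow> (\<lambda>x \<in> carrier L. x) \<in> tdli_hom L L"
proof -
  assume L: "L \<in> tdli0_objects"
  then interpret tdli0_object L by unfold_locales
  show ?thesis
    by (simp add: tdli_hom_def tense_sig_hom_id ops_closed_tdli0[OF L] preserves_op1_def)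
qed

lemma tki_hom_id: "U \<in> itki_objects \<Longrightarrow> (\<lambda>x \<in> carrier U. x) \<in> tki_hom U U"
proof -
  assume U: "U \<in> itki_objects"
  then interpret itki_object U by unfold_locales
  show ?thesis
    by (simp add: tki_hom_def tense_sig_hom_id ops_closed_itki[OF U] preserves_op1_def)
qed

lemma tdli_hom_compose:
  assumes L: "L \<in> tdli0_objects" and "f \<in> tdli_hom L M" "g \<in> tdli_hom M N"
  shows "compose (carrier L) g f \<in> tdli_hom L N"
proof -
  interpret tdli0_object L using L by unfold_locales
  have "f x \<in> carrier M" if "x \<in> carrier L" for x
    using assms that by (auto simp: tdli_hom_def tense_sig_hom_def)
  then show ?thesis
    using assms tense_sig_hom_compose[OF ops_closed_tdli0[OF L], of f M g N]
    by (simp add: tdli_hom_def preserves_op1_def compose_eq)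
qed

lemma tki_hom_compose:
  assumes U: "U \<in> itki_objects" and "f \<in> tki_hom U V" "g \<in> tki_hom V W"
  shows "compose (carrier U) g f \<in> tki_hom U W"
proof -
  interpret itki_object U using U by unfold_locales
  have "f x \<in> carrier V" if "x \<in> carrier U" for x
    using assms that by (auto simp: tki_hom_def tense_sig_hom_def)
  then show ?thesis
    using assms tense_sig_hom_compose[OF ops_closed_itki[OF U], of f V g W]
    by (simp add: tki_hom_def preserves_op1_def compose_eq)
qed

lemma category_tDLI0: "category tDLI0"
  unfolding tDLI0_def
  by (rule category_algebra_category)
    (auto simp: tdli_hom_id tdli_hom_compose, auto simp: tdli_hom_def tense_sig_hom_def)

lemma category_itKIc: "category itKIc"
  unfolding itKIc_def
  by (rule category_algebra_category)
    (auto simp: tki_hom_id tki_hom_compose, auto simp: tki_hom_def tense_sig_hom_def)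

lemma iso_arr_tDLI0:
  assumes L: "L \<in> tdli0_objects" "M \<in> tdli0_objects" and f: "f \<in> tdli_hom L M"
    and bij: "bij_betw f (carrier L) (carrier M)"
  shows "iso_arr tDLI0 (L, f, M)"
proof -
  interpret tdli0_object L using L by unfold_locales
  have "restrict (inv_into (carrier L) f) (carrier M) \<in> tdli_hom M L"
    using f bij tense_sig_hom_inv[OF ops_closed_tdli0[OF L(1)] _ bij]
    by (simp add: tdli_hom_def preserves_op1_inv)
  with assms show ?thesis
    unfolding tDLI0_def by (intro iso_arr_algebra_category) simp_all
qed

lemma iso_arr_itKIc:
  assumes U: "U \<in> itki_objects" "V \<in> itki_objects" and f: "f \<in> tki_hom U V"
    and bij: "bij_betw f (carrier U) (carrier V)"
  shows "iso_arr itKIc (U, f, V)"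
proof -
  interpret itki_object U using U by unfold_locales
  interpret V: itki_object V using U by unfold_locales
  have "inv_into (carrier U) f (center_of V) = center_of U"
    using f bij inv_into_f_f[of f "carrier U" "center_of U"] by (simp add: tki_hom_def bij_betw_def)
  then have "restrict (inv_into (carrier U) f) (carrier V) \<in> tki_hom V U"
    using f bij tense_sig_hom_inv[OF ops_closed_itki[OF U(1)] _ bij]
    by (simp add: tki_hom_def preserves_op1_inv)
  with assms show ?thesis
    unfolding itKIc_def by (intro iso_arr_algebra_category) simp_all
qed

section \<open>The equivalence\<close>

lemma K_obj_closed: "L \<in> tdli0_objects \<Longrightarrow> K_obj L \<in> itki_objects"
  by (rule univ_tdli0_object.K_object) (simp add: univ_tdli0_object_def tdli0_object_def)

lemma C_obj_simps:
  "carrier (C_obj U) = {x \<in> carrier U. meet_le (meet_of U) (center_of U) x}"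
  "meet_of (C_obj U) = meet_of U"
  "join_of (C_obj U) = join_of U"
  "imp_of (C_obj U) = imp_of U"
  "zero_of (C_obj U) = center_of U"
  "one_of (C_obj U) = one_of U"
  "G_of (C_obj U) = G_of U"
  "H_of (C_obj U) = H_of U"
  "F_of (C_obj U) = dual_op (neg_of U) (G_of U)"
  "P_of (C_obj U) = dual_op (neg_of U) (H_of U)"
  by (simp_all add: C_obj_def)

lemma C_obj_closed:
  assumes "U \<in> itki_objects" shows "C_obj U \<in> tdli0_objects"
proof -
  interpret itki_object U using assms by unfold_locales
  show ?thesis
    using upset_of_center by (simp add: tdli0_objects_def C_obj_simps)
qed

lemma tdli_homD:
  assumes "f \<in> tdli_hom L M"
  shows "\<And>x. x \<in> carrier L \<Longrightarrow> f x \<in> carrier M"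
    and "\<And>x. x \<notin> carrier L \<Longrightarrow> f x = undefined"
    and "\<And>x y. \<lbrakk>x \<in> carrier L; y \<in> carrier L\<rbrakk> \<Longrightarrow> f (meet_of L x y) = meet_of M (f x) (f y)"
    and "\<And>x y. \<lbrakk>x \<in> carrier L; y \<in> carrier L\<rbrakk> \<Longrightarrow> f (join_of L x y) = join_of M (f x) (f y)"
    and "\<And>x y. \<lbrakk>x \<in> carrier L; y \<in> carrier L\<rbrakk> \<Longrightarrow> f (imp_of L x y) = imp_of M (f x) (f y)"
    and "f (zero_of L) = zero_of M" and "f (one_of L) = one_of M"
    and "\<And>x. x \<in> carrier L \<Longrightarrow> f (G_of L x) = G_of M (f x)"
    and "\<And>x. x \<in> carrier L \<Longrightarrow> f (H_of L x) = H_of M (f x)"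
    and "\<And>x. x \<in> carrier L \<Longrightarrow> f (F_of L x) = F_of M (f x)"
    and "\<And>x. x \<in> carrier L \<Longrightarrow> f (P_of L x) = P_of M (f x)"
  using assms
  by (auto simp: tdli_hom_def tense_sig_hom_def preserves_op1_def preserves_op2_def PiE_iff
      extensional_def)

lemma tki_homD:
  assumes "f \<in> tki_hom U V"
  shows "\<And>x. x \<in> carrier U \<Longrightarrow> f x \<in> carrier V"
    and "\<And>x. x \<notin> carrier U \<Longrightarrow> f x = undefined"
    and "\<And>x y. \<lbrakk>x \<in> carrier U; y \<in> carrier U\<rbrakk> \<Longrightarrow> f (meet_of U x y) = meet_of V (f x) (f y)"
    and "\<And>x y. \<lbrakk>x \<in> carrier U; y \<in> carrier U\<rbrakk> \<Longrightarrow> f (join_of U x y) = join_of V (f x) (f y)"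
    and "\<And>x y. \<lbrakk>x \<in> carrier U; y \<in> carrier U\<rbrakk> \<Longrightarrow> f (imp_of U x y) = imp_of V (f x) (f y)"
    and "f (zero_of U) = zero_of V" and "f (one_of U) = one_of V"
    and "\<And>x. x \<in> carrier U \<Longrightarrow> f (G_of U x) = G_of V (f x)"
    and "\<And>x. x \<in> carrier U \<Longrightarrow> f (H_of U x) = H_of V (f x)"
    and "\<And>x. x \<in> carrier U \<Longrightarrow> f (neg_of U x) = neg_of V (f x)"
    and "f (center_of U) = center_of V"
  using assms
  by (auto simp: tki_hom_def tense_sig_hom_def preserves_op1_def preserves_op2_def PiE_iff
      extensional_def)

text \<open>A homomorphism sends disjoint elements to disjoint elements, as it preserves meet and
  zero.\<close>

lemma K_map_closed:
  assumes f: "f \<in> tdli_hom L M" and "Pair a b \<in> carrier (K_obj L)"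
  shows "Pair (f a) (f b) \<in> carrier (K_obj M)"
  using assms(2) by (simp add: K_mem tdli_homD[OF f] flip: tdli_homD(3,6)[OF f])

lemma K_map_hom:
  assumes L: "L \<in> tdli0_objects" and f: "f \<in> tdli_hom L M"
  shows "(\<lambda>u \<in> carrier (K_obj L). Pair (f (pfst u)) (f (psnd u))) \<in> tki_hom (K_obj L) (K_obj M)"
proof -
  interpret tdli0_object L using L by unfold_locales
  interpret K: itki_object "K_obj L" using K_obj_closed[OF L] by unfold_locales
  note K = K_map_closed[OF f]
  show ?thesis
    unfolding tki_hom_def tense_sig_hom_def preserves_op1_def preserves_op2_def
    by (auto simp: K) (auto elim!: K_elim simp: K K_simps tdli_homD[OF f] K_mem[of _ _ L])
qed

lemma C_map_closed:
  assumes f: "f \<in> tki_hom U V" and "x \<in> carrier (C_obj U)" "center_of U \<in> carrier U"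
  shows "f x \<in> carrier (C_obj V)"
  using assms(2-) by (simp add: C_obj_simps tki_homD[OF f] meet_le_def flip: tki_homD(3,11)[OF f])

text \<open>\<open>F\<close> and \<open>P\<close> of the upset are composed from negation,
  \<open>G\<close> and \<open>H\<close>, so they are preserved along with these.\<close>

lemma C_map_hom:
  assumes U: "U \<in> itki_objects" and f: "f \<in> tki_hom U V"
  shows "restrict f (carrier (C_obj U)) \<in> tdli_hom (C_obj U) (C_obj V)"
proof -
  interpret itki_object U using U by unfold_locales
  interpret C: tdli0_object "C_obj U" using C_obj_closed[OF U] by unfold_locales
  have subset: "x \<in> carrier U" if "x \<in> carrier (C_obj U)" for x
    using that by (simp add: C_obj_simps)
  note C = C_map_closed[OF f _ center_closed]
  note C_closed = C.meet_closed C.join_closed C.imp_closed C.G_closed C.H_closed C.F_closed C.P_closed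
    C.zero_closed C.one_closed
  show ?thesis
    unfolding tdli_hom_def tense_sig_hom_def preserves_op1_def preserves_op2_def
    by (auto simp: C C_closed) (auto dest!: subset simp: C_obj_simps dual_op_def tki_homD[OF f])
qed

lemma functor_K: "cat_functor tDLI0 itKIc K_functor"
proof -
  interpret D: category tDLI0 by (rule category_tDLI0)
  interpret E: category itKIc by (rule category_itKIc)
  \<comment> \<open>Places the image of a pair in the carrier on which the next restricted map is
    defined, as composition requires.\<close>
  have disjoint: "meet_of M (f a) (f b) = zero_of M"
    if "f \<in> tdli_hom L M" "a \<in> carrier L" "b \<in> carrier L" "meet_of L a b = zero_of L"
    for f a b and L M :: "'a univ tdli"
    using that(2-) by (simp add: tdli_homD(6)[OF that(1)] flip: tdli_homD(3)[OF that(1)])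
  show ?thesis
    by (unfold_locales; (simp only: split_paired_all)?;
        simp add: tDLI0_def itKIc_def K_functor_def K_obj_closed K_map_hom compose_def;
        rule ext; auto simp: K_mem tdli_homD(1) disjoint elim!: K_elim)
qed

lemma functor_C: "cat_functor itKIc tDLI0 C_functor"
proof -
  interpret D: category tDLI0 by (rule category_tDLI0)
  interpret E: category itKIc by (rule category_itKIc)
  have center: "center_of U \<in> carrier U" if "U \<in> itki_objects" for U :: "'a univ tki"
  proof -
    interpret itki_object U using that by unfold_locales
    show ?thesis by simp
  qed
  show ?thesis
    by (unfold_locales; (simp only: split_paired_all)?;
        simp add: tDLI0_def itKIc_def C_functor_def C_obj_closed C_map_hom compose_def;
        rule ext; auto simp: C_map_closed center; auto simp: C_obj_simps)
qed

section \<open>The components of the natural isomorphisms\<close>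

lemma alpha_hom:
  assumes L: "L \<in> tdli0_objects"
  shows "(\<lambda>x \<in> carrier L. Pair x (zero_of L)) \<in> tdli_hom L (C_obj (K_obj L))"
proof -
  interpret univ_tdli0_object L using L by unfold_locales
  show ?thesis
    unfolding tdli_hom_def tense_sig_hom_def preserves_op1_def preserves_op2_def
    \<comment> \<open>\<open>G_zero\<close> and \<open>H_zero\<close> enter through \<open>F\<close>
      and \<open>P\<close>: the dual operators send \<open>Pair x (zero_of L)\<close> to a pair
      whose second coordinate is \<open>G\<close> or \<open>H\<close> of zero.\<close>
    by (auto simp: C_obj_simps K_mem K_simps K_le G_zero H_zero)
qed

text \<open>A pair above the center has second coordinate zero, so the first projection inverts the
  map.\<close>

lemma alpha_bij:
  assumes L: "L \<in> tdli0_objects"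
  shows "bij_betw (\<lambda>x \<in> carrier L. Pair x (zero_of L)) (carrier L) (carrier (C_obj (K_obj L)))"
proof -
  interpret univ_tdli0_object L using L by unfold_locales
  show ?thesis
    by (rule bij_betw_byWitness[where f' = pfst])
      (auto simp: C_obj_simps K_mem K_simps K_le elim!: K_elim)
qed

lemma beta_hom:
  assumes U: "U \<in> itki_objects"
  shows "(\<lambda>x \<in> carrier U. Pair (join_of U x (center_of U)) (join_of U (neg_of U x) (center_of U)))
    \<in> tki_hom U (K_obj (C_obj U))"
proof -
  interpret itki_object U using U by unfold_locales
  show ?thesis
    unfolding tki_hom_def tense_sig_hom_def preserves_op1_def preserves_op2_def
    by (auto simp: C_obj_simps K_mem K_simps center_pair_disjoint join_center_meet join_center_join
      neg_meet neg_join join_center_imp join_center_neg_imp neg_zero neg_one G_join_center H_join_center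
      F_neg_join_center P_neg_join_center)
qed

lemma beta_bij:
  assumes U: "U \<in> itki_objects"
  shows "bij_betw
    (\<lambda>x \<in> carrier U. Pair (join_of U x (center_of U)) (join_of U (neg_of U x) (center_of U)))
    (carrier U) (carrier (K_obj (C_obj U)))" (is "bij_betw ?f _ _")
proof -
  interpret itki_object U using U by unfold_locales
  have "?f ` carrier U \<subseteq> carrier (K_obj (C_obj U))"
    using tki_homD(1)[OF beta_hom[OF U]] by blast
  moreover have "u \<in> ?f ` carrier U" if "u \<in> carrier (K_obj (C_obj U))" for u
    using that
  proof (rule K_elim)
    fix a b assume ab: "u = Pair a b" "a \<in> carrier (C_obj U)" "b \<in> carrier (C_obj U)"
      "meet_of (C_obj U) a b = zero_of (C_obj U)"
    \<comment> \<open>Surjectivity is (CK): zero of the upset is the center, so a disjoint pair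
      there satisfies its hypotheses.\<close>
    then obtain z where "z \<in> carrier U" "join_of U z (center_of U) = a"
        "join_of U (neg_of U z) (center_of U) = b"
      using CK[of a b] by (auto simp: C_obj_simps)
    then show ?thesis
      using ab by (intro image_eqI[of _ _ z]) auto
  qed
  moreover have "inj_on ?f (carrier U)"
    by (auto intro!: inj_onI center_pair_inject)
  ultimately show ?thesis
    by (auto simp: bij_betw_def)
qed

section \<open>Naturality and the equivalence\<close>

lemma natural_alpha: "natural_isomorphism tDLI0 tDLI0 id_functor (comp_functor C_functor K_functor) alpha"
proof -
  interpret id: cat_functor tDLI0 tDLI0 id_functor
    by (rule cat_functor_id[OF category_tDLI0])
  interpret CK: cat_functor tDLI0 tDLI0 "comp_functor C_functor K_functor"
    by (rule cat_functor_comp[OF functor_K functor_C])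
  show ?thesis
  proof
    fix L :: "'a univ tdli" assume "L \<in> Obj tDLI0"
    then have L: "L \<in> tdli0_objects" by (simp add: tDLI0_def)
    then show "alpha L \<in> Arr tDLI0" "Dom tDLI0 (alpha L) = OMap id_functor L"
      "Cod tDLI0 (alpha L) = OMap (comp_functor C_functor K_functor) L"
      by (simp_all add: tDLI0_def alpha_def alpha_hom K_obj_closed C_obj_closed
          id_functor_def comp_functor_def C_functor_def K_functor_def)
    show "iso_arr tDLI0 (alpha L)"
      unfolding alpha_def
      by (intro iso_arr_tDLI0 alpha_hom alpha_bij K_obj_closed C_obj_closed L)
  next
    fix \<phi> :: "('a univ, 'a univ tdli) arrow" assume "\<phi> \<in> Arr tDLI0"
    then obtain L f M where \<phi>: "\<phi> = (L, f, M)" "L \<in> tdli0_objects" "M \<in> tdli0_objects" "f \<in> tdli_hom L M"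
      by (cases \<phi>) (auto simp: tDLI0_def)
    \<comment> \<open>Membership in both carriers lets the two nested restrictions be evaluated; the
      square then commutes because \<open>f\<close> preserves zero.\<close>
    have "Pair x (zero_of L) \<in> carrier (C_obj (K_obj L))" "Pair x (zero_of L) \<in> carrier (K_obj L)"
      if "x \<in> carrier L" for x
      using tdli_homD(1)[OF alpha_hom[OF \<phi>(2)] that] that by (auto simp: C_obj_simps)
    then show "Comp tDLI0 (AMap (comp_functor C_functor K_functor) \<phi>) (alpha (Dom tDLI0 \<phi>)) =
        Comp tDLI0 (alpha (Cod tDLI0 \<phi>)) (AMap id_functor \<phi>)"
      by (auto simp: tDLI0_def \<phi>(1) alpha_def id_functor_def comp_functor_def C_functor_def
          K_functor_def compose_def fun_eq_iff tdli_homD[OF \<phi>(4)])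
  qed
qed

lemma natural_beta: "natural_isomorphism itKIc itKIc id_functor (comp_functor K_functor C_functor) beta"
proof -
  interpret id: cat_functor itKIc itKIc id_functor
    by (rule cat_functor_id[OF category_itKIc])
  interpret KC: cat_functor itKIc itKIc "comp_functor K_functor C_functor"
    by (rule cat_functor_comp[OF functor_C functor_K])
  show ?thesis
  proof
    fix U :: "'a univ tki" assume "U \<in> Obj itKIc"
    then have U: "U \<in> itki_objects" by (simp add: itKIc_def)
    then show "beta U \<in> Arr itKIc" "Dom itKIc (beta U) = OMap id_functor U"
      "Cod itKIc (beta U) = OMap (comp_functor K_functor C_functor) U"
      by (simp_all add: itKIc_def beta_def beta_hom K_obj_closed C_obj_closed
          id_functor_def comp_functor_def C_functor_def K_functor_def)
    show "iso_arr itKIc (beta U)"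
      unfolding beta_def
      by (intro iso_arr_itKIc beta_hom beta_bij K_obj_closed C_obj_closed U)
  next
    fix \<phi> :: "('a univ, 'a univ tki) arrow" assume "\<phi> \<in> Arr itKIc"
    then obtain U f V where \<phi>: "\<phi> = (U, f, V)" "U \<in> itki_objects" "V \<in> itki_objects" "f \<in> tki_hom U V"
      by (cases \<phi>) (auto simp: itKIc_def)
    interpret itki_object U using \<phi>(2) by unfold_locales
    \<comment> \<open>As for \<open>alpha\<close>, this evaluates the restriction; the square
      commutes because \<open>f\<close> preserves join, negation and center.\<close>
    have "Pair (join_of U x (center_of U)) (join_of U (neg_of U x) (center_of U))
        \<in> carrier (K_obj (C_obj U))"
      if "x \<in> carrier U" for x
      using tki_homD(1)[OF beta_hom[OF \<phi>(2)] that] that by simp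
    then show "Comp itKIc (AMap (comp_functor K_functor C_functor) \<phi>) (beta (Dom itKIc \<phi>)) =
        Comp itKIc (beta (Cod itKIc \<phi>)) (AMap id_functor \<phi>)"
      by (auto simp: itKIc_def \<phi>(1) beta_def id_functor_def comp_functor_def C_functor_def
          K_functor_def compose_def fun_eq_iff C_obj_simps tki_homD[OF \<phi>(4)])
  qed
qed

theorem theorem5p7:
  "categorical_equivalence
     (tDLI0 :: ('a univ tdli, ('a univ, 'a univ tdli) arrow) cat_data)
     (itKIc :: ('a univ tki, ('a univ, 'a univ tki) arrow) cat_data)
     K_functor C_functor alpha beta"
  unfolding categorical_equivalence_def
  by (intro conjI functor_K functor_C natural_alpha natural_beta)

end
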